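(* Let $V:\Omega\to\mathbb{R}$ depend only on $w(0)$. There exists a probability measure $\nu_V$ on $(\Omega,\mathcal{B})$, not depending on $t$, such that $(\hat{\mathcal{L}}_V^t)^*(\nu_V)=\nu_V$ for every $t>0$; that is, for every $t>0$ and every bounded $\mathcal{B}$-measurable $g:\Omega\to\mathbb{R}$, $$\int \hat{\mathcal{L}}_V^t(g)\,d\nu_V=\int g\,d\nu_V .$$
   Context: Let $S=\{1,\dots,n\}$ and let $L$ be a real $n\times n$ matrix with $L_{ii}<0$ for all $i$, $L_{ij}\ge 0$ for $i\ne j$, and $\sum_{i=1}^n L_{ij}=0$ for every $j$. Put $P^t=e^{tL}$ (column stochastic), and let $p_0=(p_0^1,\dots,p_0^n)$ be a probability vector with $Lp_0=0$ and all entries strictly positive. $\Omega$ is the set of right-continuous functions $w:[0,\infty)\to S$ with left limits, $\mathcal{B}$ is the $\sigma$-algebra generated by the coordinate maps $X_t(w)=w(t)$, and $\Theta_s:\Omega\to\Omega$ is $(\Theta_s w)(t)=w(t+s)$. For $t>0$ and $x\in\Omega$ let $\bar\mu_t^x$ be the measure on $(\Omega,\mathcal{B})$ (carried by $\Theta_t^{-1}(x)$) such that for $0=t_0<t_1<\dots<t_{j-1}<t\le t_j<\dots<t_r$ (no $t_k\ge t$ being allowed, in which case $j=r+1$) and $a_0,\dots,a_r\in S$, $$\bar\mu_t^x(X_{t_0}=a_0,\dots,X_{t_r}=a_r)=\frac{1}{p_0^{x(0)}}\,P^{t-t_{j-1}}_{x(0)\,a_{j-1}}\Big(\prod_{k=1}^{j-1}P^{t_k-t_{k-1}}_{a_k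 a_{k-1}}\Big)p_0^{a_0}$$ if $a_k=x(t_k-t)$ for all $k\ge j$, and $0$ otherwise. For bounded measurable $\varphi$ define $\mathcal{L}^t(\varphi)(x)=\int\varphi\,d\bar\mu_t^x$ for every $x\in\Omega$. Let $V:\Omega\to\mathbb{R}$ satisfy $V(w)=V_{w(0)}$ for real numbers $V_1,\dots,V_n$; also write $V$ for the diagonal matrix with entries $V_i$. Let $\lambda(V)\in\mathbb{R}$ and let $\mu_V$ be a probability vector in $\mathbb{R}^n$ with strictly positive entries such that $e^{t(L+V)}\mu_V=e^{t\lambda(V)}\mu_V$ for all $t>0$. Write $\frac{\mu_V}{p_0}$ for the function $w\mapsto (\mu_V)_{w(0)}/p_0^{w(0)}$ on $\Omega$ and $\frac{p_0}{\mu_V}$ for its reciprocal. Define $$\hat{\mathcal{L}}_V^t(g)=\frac{p_0}{\mu_V}\,\mathcal{L}^t\Big(e^{\int_0^t (V-\lambda(V))\circ\Theta_s\,ds}\,g\,\frac{\mu_V}{p_0}\Big).$$ *)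

theory Defs
  imports "HOL-Probability.Probability"
begin

text \<open>The state space \<open>S\<close> is a finite type \<open>'n\<close>; \<open>A $ i $ j\<close> is the entry in
  row \<open>i\<close> and column \<open>j\<close>.\<close>

definition mexp :: "real^'n^'n \<Rightarrow> real^'n^'n" where
  "mexp A = (\<Sum>k. (((**) A) ^^ k) (mat 1) /\<^sub>R fact k)"

definition diag_mat :: "real^'n \<Rightarrow> real^'n^'n" where
  "diag_mat v = (\<chi> i j. if i = j then v $ i else 0)"

definition prob_vector :: "real^'n \<Rightarrow> bool" where
  "prob_vector p \<longleftrightarrow> (\<forall>i. 0 \<le> p $ i) \<and> (\<Sum>i\<in>UNIV. p $ i) = 1"

text \<open>Functions on \<open>[0,\<infty>)\<close> are extensional functions on \<open>{0..}\<close>, so that equality of paths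
  is equality on \<open>[0,\<infty>)\<close>. Limits of paths are taken in the discrete topology of \<open>S\<close>.\<close>

definition paths :: "(real \<Rightarrow> 'n) set" where
  "paths = {w \<in> extensional {0..}.
     (\<forall>t\<ge>0. limitin (discrete_topology UNIV) w (w t) (at_right t)) \<and>
     (\<forall>t>0. \<exists>a. limitin (discrete_topology UNIV) w a (at_left t))}"

definition path_space :: "(real \<Rightarrow> 'n) measure" where
  "path_space = sigma paths {{w \<in> paths. w t \<in> A} | t A. 0 \<le> t}"

definition shift :: "real \<Rightarrow> (real \<Rightarrow> 'n) \<Rightarrow> (real \<Rightarrow> 'n)" where
  "shift s w = restrict (\<lambda>t. w (t + s)) {0..}"

text \<open>\<open>M\<close> is the measure \<open>\<mu>\<^sub>t\<^sup>x\<close>: the future \<open>\<Theta>\<^sub>t w\<close> is frozen to be \<open>x\<close>, and the past on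
  \<open>[0,t)\<close> follows the stationary chain conditioned to be in state \<open>x 0\<close> at time \<open>t\<close>. The index
  \<open>j\<close> is the first one with \<open>t \<le> t\<^sub>j\<close>, and \<open>j = r + 1\<close> if there is none. The chain is column
  stochastic: \<open>P $ a $ b\<close> is the probability of going from \<open>b\<close> to \<open>a\<close>. Prescribing the
  (finite) masses of these cylinders determines \<open>M\<close>.\<close>

definition is_past_measure ::
  "real^'n^'n \<Rightarrow> real^'n \<Rightarrow> real \<Rightarrow> (real \<Rightarrow> 'n) \<Rightarrow> (real \<Rightarrow> 'n) measure \<Rightarrow> bool" where
  "is_past_measure L p\<^sub>0 t x M \<longleftrightarrow>
     sets M = sets path_space \<and>
     (AE w in M. shift t w = x) \<and>
     (\<forall>(r::nat) (j::nat) (\<tau> :: nat \<Rightarrow> real) (a :: nat \<Rightarrow> 'n).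
        \<tau> 0 = 0 \<and> (\<forall>k<r. \<tau> k < \<tau> (Suc k)) \<and>
        1 \<le> j \<and> j \<le> r + 1 \<and> \<tau> (j - 1) < t \<and> (j \<le> r \<longrightarrow> t \<le> \<tau> j) \<longrightarrow>
        emeasure M {w \<in> paths. \<forall>k\<le>r. w (\<tau> k) = a k} =
          ennreal (if \<forall>k\<in>{j..r}. a k = x (\<tau> k - t)
            then 1 / p\<^sub>0 $ x 0 *
                 (mexp ((t - \<tau> (j - 1)) *\<^sub>R L) $ x 0 $ a (j - 1) *
                  (\<Prod>k=1..j - 1. mexp ((\<tau> k - \<tau> (k - 1)) *\<^sub>R L) $ a k $ a (k - 1)) *
                  p\<^sub>0 $ a 0)
            else 0))"

definition transfer_op ::
  "(real \<Rightarrow> (real \<Rightarrow> 'n) \<Rightarrow> (real \<Rightarrow> 'n) measure) \<Rightarrow> real \<Rightarrow> ((real \<Rightarrow> 'n) \<Rightarrow> real) \<Rightarrow>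
     (real \<Rightarrow> 'n) \<Rightarrow> real" where
  "transfer_op \<mu> t \<phi> x = (\<integral>w. \<phi> w \<partial>\<mu> t x)"

definition normalized_op ::
  "(real \<Rightarrow> (real \<Rightarrow> 'n) \<Rightarrow> (real \<Rightarrow> 'n) measure) \<Rightarrow> real^'n \<Rightarrow> ((real \<Rightarrow> 'n) \<Rightarrow> real) \<Rightarrow>
     real \<Rightarrow> real^'n \<Rightarrow> real \<Rightarrow> ((real \<Rightarrow> 'n) \<Rightarrow> real) \<Rightarrow> (real \<Rightarrow> 'n) \<Rightarrow> real" where
  "normalized_op \<mu> p\<^sub>0 V lam \<mu>\<^sub>V t g x =
     (p\<^sub>0 $ x 0 / \<mu>\<^sub>V $ x 0) *
     transfer_op \<mu> t
       (\<lambda>w. exp (LBINT s:{0..t}. (V (shift s w) - lam)) * g w * (\<mu>\<^sub>V $ w 0 / p\<^sub>0 $ w 0)) x"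

end

theory Submission
  imports Defs
begin

text \<open>
  Write \<open>A = L + V - \<lambda>(V)\<close> and \<open>E\<^sup>h = e\<^bsup>hA\<^esup>\<close>, so \<open>A \<mu>\<^sub>V = 0\<close>. Since \<open>A\<close> has nonnegative off-diagonal entries and a
  strictly positive kernel vector, it also has a nonnegative left kernel vector \<open>\<eta>\<close>, normalised by
  \<open>\<eta> \<bullet> \<mu>\<^sub>V = 1\<close>. The measure \<open>\<nu>\<close> is the stationary Markov chain with
  \<open>\<nu>(X\<^sub>s = a, X\<^bsub>s+h\<^esub> = b) = \<eta>\<^sub>b E\<^sup>h\<^bsub>ba\<^esub> (\<mu>\<^sub>V)\<^sub>a\<close>, and similarly for more times.
  The Feynman-Kac formula, obtained from Riemann sums and the Trotter product formula, shows that the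
  normalised operator is integration against a probability kernel whose cylinder masses are given by
  \<open>E\<close>; invariance is then the semigroup law of \<open>E\<close> together with \<open>\<eta> E\<^sup>h = \<eta>\<close>.

  Existence of \<open>\<nu>\<close> on cadlag paths needs no general construction of Markov processes: the kernel for
  \<open>t = 1\<close>, mixed over the frozen terminal state and conditioned on the initial state, supplies the chain on
  \<open>[0, 1]\<close>, and independent copies are glued end to end.
\<close>

text \<open>Since \<open>L\<close> may be reducible, \<eta> may vanish at some states. Conditioning
  on such a state is impossible, so identities for a fixed starting state \<open>b\<close> are
  stated after multiplication by \<open>\<eta> $ b\<close>. The zero states of \<eta> form a class
  that the dynamics cannot leave, which makes both sides 0 there. Laws are tested on products of
  functions of the state at nondecreasing, possibly repeated times. Exponentials of Riemann sums are
  such products, and so is a conditional expectation given one state; both invariance and gluing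
  thereby reduce to inserting one more factor into a list. The measures with frozen future already
  live on right-continuous paths with left limits. Reweighting, mixing and gluing preserve this, so
  regularity of paths is inherited and never has to be proved from finite-dimensional distributions.
  Subtracting \<lambda>(V) from the potential turns the eigenvector equation into a kernel equation,
  and the scalar factor depending on \<open>t\<close> disappears.\<close>

section \<open>Matrix exponentials\<close>

text \<open>The product on \<open>real^'n^'n\<close> is componentwise; on this copy of the type it is the matrix product and the
  norm is the operator norm, so that the library theory of \<open>exp\<close> in Banach algebras applies.\<close>

typedef 'n sqmat = "UNIV :: (real^'n^'n) set"
  morphisms mat_of sqmat_of by simp

setup_lifting type_definition_sqmat

instantiation sqmat :: (finite) real_normed_vector
begin

lift_definition zero_sqmat :: "'a sqmat" is 0 .
lift_definition plus_sqmat :: "'a sqmat \<Rightarrow> 'a sqmat \<Rightarrow> 'a sqmat" is "(+)" .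
lift_definition minus_sqmat :: "'a sqmat \<Rightarrow> 'a sqmat \<Rightarrow> 'a sqmat" is "(-)" .
lift_definition uminus_sqmat :: "'a sqmat \<Rightarrow> 'a sqmat" is "uminus" .
lift_definition scaleR_sqmat :: "real \<Rightarrow> 'a sqmat \<Rightarrow> 'a sqmat" is "scaleR" .
lift_definition norm_sqmat :: "'a sqmat \<Rightarrow> real" is "\<lambda>A. onorm ((*v) A)" .

definition dist_sqmat :: "'a sqmat \<Rightarrow> 'a sqmat \<Rightarrow> real" where
  "dist_sqmat A B = norm (A - B)"
definition sgn_sqmat :: "'a sqmat \<Rightarrow> 'a sqmat" where
  "sgn_sqmat A = inverse (norm A) *\<^sub>R A"
definition uniformity_sqmat :: "('a sqmat \<times> 'a sqmat) filter" where
  "uniformity_sqmat = (INF e\<in>{0<..}. principal {(x, y). dist x y < e})"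
definition open_sqmat :: "'a sqmat set \<Rightarrow> bool" where
  "open_sqmat S = (\<forall>x\<in>S. \<forall>\<^sub>F (x', y) in uniformity. x' = x \<longrightarrow> y \<in> S)"

instance
proof
  show "norm A = 0 \<longleftrightarrow> A = 0" for A :: "'a sqmat"
  proof (transfer, safe)
    fix A :: "real^'a^'a" assume "onorm ((*v) A) = 0"
    then have "\<bar>A $ i $ j\<bar> \<le> 0" for i j
      using matrix_component_le_onorm[of A i j] by simp
    then show "A = 0" by (simp add: vec_eq_iff)
  next
    show "onorm ((*v) (0::real^'a^'a)) = 0"
      by (simp add: onorm_zero ext[where f = "(*v) (0::real^'a^'a)" and g = "\<lambda>_. 0"])
  qed
  show "norm (A + B) \<le> norm A + norm B" for A B :: "'a sqmat"
  proof transfer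
    fix A B :: "real^'a^'a"
    have "(*v) (A + B) = (\<lambda>x. A *v x + B *v x)"
      by (simp add: fun_eq_iff matrix_vector_mult_add_rdistrib)
    then show "onorm ((*v) (A + B)) \<le> onorm ((*v) A) + onorm ((*v) B)"
      using onorm_triangle[of "(*v) A" "(*v) B"] by simp
  qed
  show "norm (a *\<^sub>R A) = \<bar>a\<bar> * norm A" for a and A :: "'a sqmat"
  proof transfer
    fix A :: "real^'a^'a" and a
    have "(*v) (a *\<^sub>R A) = (\<lambda>x. a *\<^sub>R (A *v x))"
      by (simp add: fun_eq_iff scaleR_matrix_vector_assoc)
    then show "onorm ((*v) (a *\<^sub>R A)) = \<bar>a\<bar> * onorm ((*v) A)"
      using onorm_scaleR[of "(*v) A" a] by simp
  qed
qed (simp_all only: dist_sqmat_def sgn_sqmat_def uniformity_sqmat_def open_sqmat_def,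
     (transfer, simp add: scaleR_add_left scaleR_add_right)+)

end

text \<open>Operator norm and Euclidean norm are equivalent: the Euclidean norm is at most the sum
  of the absolute entries, and each entry is at most the operator norm. With the converse bound,
  convergence and completeness pass between the two copies of the matrix space.\<close>

lemma norm_mat_of_le: "norm (mat_of A) \<le> (real CARD('n))^2 * norm (A :: 'n::finite sqmat)"
proof -
  have "norm (mat_of A) \<le> (\<Sum>i\<in>UNIV. \<Sum>j\<in>UNIV. \<bar>mat_of A $ i $ j\<bar>)"
    unfolding norm_vec_def[where x = "mat_of A"]
    by (intro order_trans[OF L2_set_le_sum] sum_mono norm_le_l1_cart) auto
  also have "\<dots> \<le> (\<Sum>i\<in>(UNIV::'n set). \<Sum>j\<in>(UNIV::'n set). norm A)"
    by (intro sum_mono) (simp only: norm_sqmat.rep_eq matrix_component_le_onorm)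
  finally show ?thesis by (simp add: power2_eq_square del: mult.assoc)
qed


lemma norm_le_norm_mat_of: "norm (A :: 'n::finite sqmat) \<le> (real CARD('n))^2 * norm (mat_of A)"
proof -
  have "\<bar>mat_of A $ i $ j\<bar> \<le> norm (mat_of A)" for i j
    using order_trans[OF component_le_norm_cart Finite_Cartesian_Product.norm_nth_le] .
  from onorm_le_matrix_component[of "mat_of A", OF this]
  show ?thesis by (simp add: norm_sqmat.rep_eq power2_eq_square)
qed

lemma bounded_linear_mat_of: "bounded_linear (mat_of :: 'n::finite sqmat \<Rightarrow> _)"
  by (rule bounded_linear_intro[where K = "(real CARD('n))^2"])
    (simp_all add: plus_sqmat.rep_eq scaleR_sqmat.rep_eq norm_mat_of_le mult.commute[of "norm _"])

lemma bounded_linear_sqmat_of: "bounded_linear (sqmat_of :: _ \<Rightarrow> 'n::finite sqmat)"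
proof (rule bounded_linear_intro[where K = "(real CARD('n))^2"])
  show "norm (sqmat_of x :: 'n sqmat) \<le> norm x * (real CARD('n))^2" for x
    using norm_le_norm_mat_of[of "sqmat_of x"] by (simp add: sqmat_of_inverse mult.commute)
qed (simp_all add: plus_sqmat.abs_eq scaleR_sqmat.abs_eq)

instance sqmat :: (finite) banach
proof
  fix X :: "nat \<Rightarrow> 'a sqmat" assume "Cauchy X"
  then have "Cauchy (\<lambda>n. mat_of (X n))"
    by (rule bounded_linear.Cauchy[OF bounded_linear_mat_of])
  then obtain A where "(\<lambda>n. mat_of (X n)) \<longlonglongrightarrow> A"
    using Cauchy_convergent_iff convergent_def by blast
  then have "(\<lambda>n. sqmat_of (mat_of (X n)) :: 'a sqmat) \<longlonglongrightarrow> sqmat_of A"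
    by (rule bounded_linear.tendsto[OF bounded_linear_sqmat_of])
  then show "convergent X"
    by (auto simp: mat_of_inverse convergent_def)
qed

instantiation sqmat :: (finite) real_normed_algebra_1
begin

lift_definition one_sqmat :: "'a sqmat" is "mat 1" .
lift_definition times_sqmat :: "'a sqmat \<Rightarrow> 'a sqmat \<Rightarrow> 'a sqmat" is "(**)" .

instance
proof
  fix A B C :: "'a sqmat" and a :: real
  show "A * B * C = A * (B * C)" by transfer (simp add: matrix_mul_assoc)
  show "1 * A = A" "A * 1 = A" by (transfer, simp)+
  show "(A + B) * C = A * C + B * C"
    by transfer (simp add: matrix_matrix_mult_def vec_eq_iff sum.distrib distrib_right)
  show "A * (B + C) = A * B + A * C"
    by transfer (simp add: matrix_add_ldistrib)
  show "a *\<^sub>R A * B = a *\<^sub>R (A * B)" 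
    by transfer (simp add: matrix_matrix_mult_def vec_eq_iff sum_distrib_left mult.assoc)
  show "A * a *\<^sub>R B = a *\<^sub>R (A * B)" 
    by transfer (simp add: matrix_matrix_mult_def vec_eq_iff sum_distrib_left algebra_simps)
  show "norm (A * B) \<le> norm A * norm B"
    using onorm_compose[of "(*v) (mat_of A)" "(*v) (mat_of B)"]
    by transfer (simp add: comp_def matrix_vector_mul_assoc)
  show "norm (1::'a sqmat) = 1"
    proof transfer
    have "(*v) (mat 1 :: real^'a^'a) = (\<lambda>x. x)"
      by (simp add: fun_eq_iff)
    then show "onorm ((*v) (mat 1 :: real^'a^'a)) = 1"
      using onorm_id by simp
  qed
  show "(0::'a sqmat) \<noteq> 1"
    by transfer (simp add: vec_eq_iff mat_def)
qed

end

text \<open>\<open>mat_of\<close> is bounded linear, so it can be taken inside the convergent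
  exponential series.\<close>

lemma mexp_eq_exp: "mexp A = mat_of (exp (sqmat_of A))"
proof -
  have pow: "(((**) A) ^^ k) (mat 1) = mat_of (sqmat_of A ^ k)" for k
    by (induction k) (simp_all add: one_sqmat.rep_eq times_sqmat.rep_eq sqmat_of_inverse)
  have "mat_of (exp (sqmat_of A)) = (\<Sum>k. mat_of (sqmat_of A ^ k /\<^sub>R fact k))"
    unfolding exp_def
    by (rule bounded_linear.suminf[OF bounded_linear_mat_of summable_exp_generic])
  then show ?thesis
    by (simp add: mexp_def pow scaleR_sqmat.rep_eq)
qed

lemma mexp_0 [simp]: "mexp 0 = mat 1"
  by (simp add: mexp_eq_exp flip: zero_sqmat.abs_eq one_sqmat.rep_eq)

lemma mexp_add: "mexp ((s + t) *\<^sub>R A) = mexp (s *\<^sub>R A) ** mexp (t *\<^sub>R A)"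
  by (simp add: mexp_eq_exp scaleR_left_distrib exp_add_commuting 
      flip: times_sqmat.rep_eq scaleR_sqmat.abs_eq plus_sqmat.abs_eq)

section \<open>The Trotter product formula\<close>

text \<open>Telescoping, with one error term per factor. Thanks to \<open>1 \<le> c\<close> the
  sharp exponent \<open>n - 1\<close> can be relaxed to \<open>n\<close>, which keeps the induction
  uniform.\<close>

lemma norm_power_diff_le:
  fixes a b :: "'a::real_normed_algebra_1"
  assumes "norm a \<le> c" "norm b \<le> c" "1 \<le> c"
  shows "norm (a ^ n - b ^ n) \<le> n * norm (a - b) * c ^ n"
proof (induction n)
  case (Suc n)
  have "a ^ Suc n - b ^ Suc n = a * (a ^ n - b ^ n) + (a - b) * b ^ n"
    by (simp add: algebra_simps)
  also have "norm \<dots> \<le> norm a * norm (a ^ n - b ^ n) + norm (a - b) * norm (b ^ n)"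
    by (intro norm_triangle_mono norm_mult_ineq)
  also have "\<dots> \<le> c * (n * norm (a - b) * c ^ n) + norm (a - b) * c ^ n"
    using assms Suc
    by (intro add_mono mult_mono order_trans[OF norm_power_ineq] power_mono) auto
  also have "\<dots> \<le> c * (n * norm (a - b) * c ^ n) + c * (norm (a - b) * c ^ n)"
    using assms mult_right_mono[of 1 c "norm (a - b) * c ^ n"] by simp
  finally show ?case by (simp add: algebra_simps)
qed simp

lemma exp_power_scaleR:
  fixes x :: "'a::{real_normed_algebra_1, banach}"
  shows "exp x ^ n = exp (real n *\<^sub>R x)"
proof (induction n)
  case (Suc n)
  have "exp (real (Suc n) *\<^sub>R x) = exp (x + real n *\<^sub>R x)"
    by (simp add: scaleR_left_distrib)
  also have "\<dots> = exp x * exp (real n *\<^sub>R x)"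
    by (rule exp_add_commuting) simp
  finally show ?case using Suc by simp
qed simp

text \<open>The one-step error \<open>g h\<close> vanishes at 0 together with its derivative, which
  is \<open>x + y - (x + y)\<close>; hence \<open>n\<close> times the error at
  \<open>h = 1 / n\<close> tends to 0. Both one-step factors have norm at most
  \<open>exp (C / n)\<close>, so taking \<open>n\<close>-th powers costs only the constant
  \<open>exp C\<close>.\<close>

lemma Trotter:
  fixes x y :: "'a::{real_normed_algebra_1, banach}"
  shows "(\<lambda>n. (exp (x /\<^sub>R real n) * exp (y /\<^sub>R real n)) ^ n) \<longlonglongrightarrow> exp (x + y)"
proof -
  define g where "g h = exp (h *\<^sub>R x) * exp (h *\<^sub>R y) - exp (h *\<^sub>R (x + y))" for h :: real
  define a b where "a n = exp (x /\<^sub>R real n) * exp (y /\<^sub>R real n)" 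
    and "b n = exp ((x + y) /\<^sub>R real n)" for n
  define C where "C = norm x + norm y"
  have "(g has_vector_derivative (exp (0 *\<^sub>R x) * (exp (0 *\<^sub>R y) * y) + 
      (exp (0 *\<^sub>R x) * x) * exp (0 *\<^sub>R y)) - exp (0 *\<^sub>R (x + y)) * (x + y)) (at 0)"
    unfolding g_def
    by (intro has_vector_derivative_diff has_vector_derivative_mult 
        exp_scaleR_has_vector_derivative_right)
  then have "((\<lambda>h. norm (g h) / norm h) \<longlongrightarrow> 0) (at 0)"
    by (simp add: has_vector_derivative_def has_derivative_at g_def)
  moreover have "filterlim (\<lambda>n. 1 / real n) (at 0) sequentially"
    unfolding filterlim_at
    by (auto intro!: tendsto_eq_intros lim_inverse_n' eventually_sequentiallyI[of 1])
  ultimately have "(\<lambda>n. norm (g (1 / real n)) / norm (1 / real n)) \<longlonglongrightarrow> 0"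
    by (rule filterlim_compose)
  then have "(\<lambda>n. norm (g (1 / real n)) / norm (1 / real n) * exp C) \<longlonglongrightarrow> 0"
    by (auto intro!: tendsto_eq_intros)
  then have "(\<lambda>n. a n ^ n - b n ^ n) \<longlonglongrightarrow> 0"
  proof (rule tendsto_0_le[where K = 1], intro eventually_sequentiallyI[of 1])
    fix n :: nat assume n: "1 \<le> n"
    have "norm (a n) \<le> norm (exp (x /\<^sub>R real n)) * norm (exp (y /\<^sub>R real n))"
      unfolding a_def by (rule norm_mult_ineq)
    also have "\<dots> \<le> exp (norm (x /\<^sub>R real n)) * exp (norm (y /\<^sub>R real n))"
      by (intro mult_mono norm_exp) auto
    also have "\<dots> = exp (C / n)"
      by (simp add: C_def mult_exp_exp divide_inverse_commute distrib_left)
    finally have 1: "norm (a n) \<le> exp (C / n)" .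
    have "norm (b n) \<le> exp (norm ((x + y) /\<^sub>R n))"
      unfolding b_def by (rule norm_exp)
    also have "\<dots> \<le> exp (C / n)"
      using n by (simp add: C_def divide_simps norm_triangle_ineq)
    finally have 2: "norm (b n) \<le> exp (C / n)" .
    have "1 \<le> exp (C / n)" by (simp add: C_def)
    from norm_power_diff_le[OF 1 2 this, of n] 
    have "norm (a n ^ n - b n ^ n) \<le> n * norm (a n - b n) * exp C"
      using n by (simp flip: exp_of_nat_mult)
    also have "a n - b n = g (1 / n)"
      by (simp add: a_def b_def g_def divide_inverse)
    finally show "norm (a n ^ n - b n ^ n) \<le> norm (norm (g (1 / real n)) / norm (1 / real n) * exp C) * 1"
      by (simp add: mult.commute)
  qed
  \<comment> \<open>Division by \<open>real 0\<close> gives 0, so at \<open>n = 0\<close> the left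
    side is 1; the identity starts at \<open>n = 1\<close>.\<close>
  moreover have "\<forall>\<^sub>F n in sequentially. b n ^ n = exp (x + y)"
    by (intro eventually_sequentiallyI[of 1]) (simp add: b_def exp_power_scaleR)
  ultimately have "(\<lambda>n. (a n ^ n - b n ^ n) + b n ^ n) \<longlonglongrightarrow> 0 + exp (x + y)"
    by (rule tendsto_add[OF _ tendsto_eventually])
  then show ?thesis by (simp add: a_def)
qed


section \<open>The exponential series acting on vectors and entries\<close>

lemma mexp_sums:
  assumes "bounded_linear f"
  shows "(\<lambda>k. f ((((**) A) ^^ k) (mat 1) /\<^sub>R fact k)) sums f (mexp A)"
proof -
  have pow: "(((**) A) ^^ k) (mat 1) = mat_of (sqmat_of A ^ k)" for k
    by (induction k) (simp_all add: one_sqmat.rep_eq times_sqmat.rep_eq sqmat_of_inverse)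
  have "(\<lambda>k. sqmat_of A ^ k /\<^sub>R fact k) sums exp (sqmat_of A)"
    by (rule exp_converges)
  from bounded_linear.sums[OF bounded_linear_compose[OF assms bounded_linear_mat_of] this]
  show ?thesis
    by (simp add: mexp_eq_exp pow scaleR_sqmat.rep_eq)
qed

lemma bounded_linear_matrix_vector_left: "bounded_linear (\<lambda>A :: real^'n^'m. A *v u)"
  by (intro linear_conv_bounded_linear[THEN iffD1] linearI)
    (simp_all add: matrix_vector_mult_add_rdistrib scaleR_matrix_vector_assoc)

lemma bounded_linear_vector_matrix_right: "bounded_linear (\<lambda>A :: real^'n^'m. u v* A)"
  by (intro linear_conv_bounded_linear[THEN iffD1] linearI)
    (simp_all add: vector_matrix_mult_def vec_eq_iff algebra_simps sum.distrib sum_distrib_left)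

lemma bounded_linear_entry: "bounded_linear (\<lambda>A :: real^'n^'m. A $ i $ j)"
  by (rule bounded_linear_compose[OF bounded_linear_vec_nth bounded_linear_vec_nth])

lemma sums_head: "(\<lambda>k::nat. if k = 0 then a else 0) sums (a :: 'a::real_normed_vector)"
  using sums_single[of 0 "\<lambda>_. a"] by simp

lemma mexp_ker_right:
  assumes "A *v u = 0"
  shows "mexp A *v u = u"
proof -
  have pow: "(((**) A) ^^ k) (mat 1) *v u = (if k = 0 then u else 0)" for k
    by (induction k) (simp_all add: assms flip: matrix_vector_mul_assoc)
  have "(\<lambda>k. ((((**) A) ^^ k) (mat 1) /\<^sub>R fact k) *v u) = (\<lambda>k. if k = 0 then u else 0)"
    by (simp add: fun_eq_iff pow flip: scaleR_matrix_vector_assoc)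
  then show ?thesis
    using mexp_sums[OF bounded_linear_matrix_vector_left, of A u] sums_head[of u] sums_unique2
    by metis
qed

lemma mexp_ker_left:
  assumes "u v* A = 0"
  shows "u v* mexp A = u"
proof -
  have pow: "u v* (((**) A) ^^ k) (mat 1) = (if k = 0 then u else 0)" for k
    by (cases k) (simp_all add: assms flip: vector_matrix_mul_assoc)
  have "(\<lambda>k. u v* ((((**) A) ^^ k) (mat 1) /\<^sub>R fact k)) = (\<lambda>k. if k = 0 then u else 0)"
  proof
    fix k
    have "u v* ((((**) A) ^^ k) (mat 1) /\<^sub>R fact k) = (u v* (((**) A) ^^ k) (mat 1)) /\<^sub>R fact k"
      by (rule linear_scale[OF bounded_linear.linear[OF bounded_linear_vector_matrix_right]])
    then show "u v* ((((**) A) ^^ k) (mat 1) /\<^sub>R fact k) = (if k = 0 then u else 0)"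
      by (simp add: pow)
  qed
  then show ?thesis
    using mexp_sums[OF bounded_linear_vector_matrix_right, of u A] sums_head[of u] sums_unique2
    by metis
qed

text \<open>The partial sums of the series stay in \<open>W\<close>, and a subspace in finite
  dimension is closed. It is needed for the coordinate subspace spanned by the zero states of
  \<eta>.\<close>

lemma mexp_invariant:
  assumes "subspace W" and A: "\<And>u. u \<in> W \<Longrightarrow> A *v u \<in> W" and u: "u \<in> W"
  shows "mexp A *v u \<in> W"
proof -
  have pow: "(((**) A) ^^ k) (mat 1) *v u \<in> W" for k
    by (induction k) (simp_all add: u A flip: matrix_vector_mul_assoc)
  have "(\<lambda>k. ((((**) A) ^^ k) (mat 1) /\<^sub>R fact k) *v u) sums (mexp A *v u)"
    using mexp_sums[OF bounded_linear_matrix_vector_left, of A u] .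
  then have "(\<lambda>n. \<Sum>k<n. ((((**) A) ^^ k) (mat 1) /\<^sub>R fact k) *v u) \<longlonglongrightarrow> mexp A *v u"
    by (simp add: sums_def)
  moreover have "(\<Sum>k<n. ((((**) A) ^^ k) (mat 1) /\<^sub>R fact k) *v u) \<in> W" for n
    by (intro subspace_sum[OF assms(1)])
      (simp only: pow subspace_scale[OF assms(1)] scaleR_matrix_vector_assoc[symmetric])
  ultimately show ?thesis
    by (rule closed_sequentially[OF closed_subspace[OF assms(1)], rotated])
qed

text \<open>The hypothesis covers \<open>t > 0\<close> only, so both sides are differentiated at the
  interior point \<open>t = 1\<close> instead of 0; the common factor \<open>exp lam\<close> is then
  cancelled.\<close>

lemma generator_eigenvector:
  fixes B :: "real^'n^'n"
  assumes "\<And>t. 0 < t \<Longrightarrow> mexp (t *\<^sub>R B) *v u = exp (t * lam) *\<^sub>R u"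
  shows "B *v u = lam *\<^sub>R u"
proof -
  define F where "F t = mexp (t *\<^sub>R B) *v u" for t
  have F1: "F 1 = exp lam *\<^sub>R u"
    using assms[of 1] by (simp add: F_def)
  have "((\<lambda>t. mat_of (exp (t *\<^sub>R sqmat_of B)) *v u) has_vector_derivative 
      mat_of (sqmat_of B * exp (1 *\<^sub>R sqmat_of B)) *v u) (at 1)"
    by (rule bounded_linear.has_vector_derivative[OF bounded_linear_compose
          [OF bounded_linear_matrix_vector_left bounded_linear_mat_of] 
          exp_scaleR_has_vector_derivative_left])
  then have "(F has_vector_derivative B *v F 1) (at 1)"
    unfolding F_def
    by (simp add: mexp_eq_exp[abs_def] times_sqmat.rep_eq sqmat_of_inverse matrix_vector_mul_assoc 
        flip: scaleR_sqmat.abs_eq)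
  moreover have "(F has_vector_derivative exp lam *\<^sub>R (lam *\<^sub>R u)) (at 1)"
  proof (rule has_vector_derivative_transform_within_open)
    show "((\<lambda>t. exp (t * lam) *\<^sub>R u) has_vector_derivative exp lam *\<^sub>R (lam *\<^sub>R u)) (at 1)"
      by (auto intro!: derivative_eq_intros)
    show "open {0::real<..}" by simp
    show "\<And>t. t \<in> {0<..} \<Longrightarrow> exp (t * lam) *\<^sub>R u = F t"
      by (simp add: F_def assms)
  qed simp
  ultimately have "exp lam *\<^sub>R (B *v u) = exp lam *\<^sub>R (lam *\<^sub>R u)"
    unfolding F1 
    by (metis matrix_vector_mult_scaleR vector_derivative_unique_at)
  then show ?thesis
    using scaleR_left_imp_eq exp_not_eq_zero by blast
qed

definition diag_mul :: "('n \<Rightarrow> real) \<Rightarrow> real^'n \<Rightarrow> real^'n" where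
  "diag_mul f u = (\<chi> i. f i * u $ i)"

lemma diag_mat_mult: "diag_mat v *v u = diag_mul (($) v) u"
  by (simp add: diag_mat_def diag_mul_def matrix_vector_mult_def vec_eq_iff 
      if_distrib[of "\<lambda>x. x * _"] cong: if_cong)

lemma mexp_diag_mat: "mexp (diag_mat v) = diag_mat (\<chi> i. exp (v $ i))"
proof -
  have pow: "(((**) (diag_mat v)) ^^ k) (mat 1) = diag_mat (\<chi> i. v $ i ^ k)" for k
    by (induction k) (simp_all add: diag_mat_def mat_def matrix_matrix_mult_def vec_eq_iff 
      if_distrib[of "\<lambda>x. x * _"] cong: if_cong)
  have "mexp (diag_mat v) $ i $ j = diag_mat (\<chi> i. exp (v $ i)) $ i $ j" for i j
  proof -
    have "(\<lambda>k. if i = j then v $ i ^ k /\<^sub>R fact k else 0) sums mexp (diag_mat v) $ i $ j"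
      using mexp_sums[OF bounded_linear_entry, of "diag_mat v" i j] 
      unfolding pow by (simp add: diag_mat_def if_distrib cong: if_cong)
    moreover have "(\<lambda>k. if i = j then v $ i ^ k /\<^sub>R fact k else 0) sums (if i = j then exp (v $ i) else 0)"
      using exp_converges[of "v $ i"] by auto
    ultimately show ?thesis
      using sums_unique2 by (fastforce simp: diag_mat_def)
  qed
  then show ?thesis by (simp add: vec_eq_iff)
qed

text \<open>The iterated map propagates by \<open>L\<close> over a short time and then weights by
  the exponential at the new state. This is the order in which a right-endpoint Riemann sum
  contributes its factors.\<close>

lemma Trotter_diag:
  "(\<lambda>n. ((\<lambda>u. diag_mul (\<lambda>i. exp (h / real n * v $ i)) (mexp ((h / real n) *\<^sub>R L) *v u)) ^^ n) u)
    \<longlonglongrightarrow> mexp (h *\<^sub>R (L + diag_mat v)) *v u"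
proof -
  define D where "D = sqmat_of (h *\<^sub>R diag_mat v)"
  define Q where "Q = sqmat_of (h *\<^sub>R L)"
  have e: "mat_of (exp (D /\<^sub>R real n) * exp (Q /\<^sub>R real n)) *v u =
      diag_mul (\<lambda>i. exp (h / real n * v $ i)) (mexp ((h / real n) *\<^sub>R L) *v u)" for n u
  proof -
    have "(h / real n) *\<^sub>R diag_mat v = diag_mat ((h / real n) *\<^sub>R v)"
      by (simp add: diag_mat_def vec_eq_iff)
    then have "mat_of (exp (D /\<^sub>R real n)) = diag_mat (\<chi> i. exp (h / real n * v $ i))"
      using mexp_diag_mat[of "(h / real n) *\<^sub>R v"]
      by (simp add: mexp_eq_exp D_def scaleR_sqmat.abs_eq divide_inverse_commute)
    moreover have "mat_of (exp (Q /\<^sub>R real n)) = mexp ((h / real n) *\<^sub>R L)"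
      by (simp add: mexp_eq_exp Q_def scaleR_sqmat.abs_eq divide_inverse_commute)
    ultimately show ?thesis
      by (simp add: times_sqmat.rep_eq diag_mat_mult flip: matrix_vector_mul_assoc) 
        (simp add: diag_mul_def)
  qed
  have pow: "mat_of (a ^ n) *v u = (((*v) (mat_of a)) ^^ n) u" for a :: "'a sqmat" and n
    by (induction n) (simp_all add: one_sqmat.rep_eq times_sqmat.rep_eq flip: matrix_vector_mul_assoc)
  have "(\<lambda>n. mat_of ((exp (D /\<^sub>R real n) * exp (Q /\<^sub>R real n)) ^ n) *v u) \<longlonglongrightarrow> mat_of (exp (D + Q)) *v u"
    by (intro bounded_linear.tendsto[OF bounded_linear_compose
          [OF bounded_linear_matrix_vector_left bounded_linear_mat_of]] Trotter)
  moreover have "mat_of (exp (D + Q)) = mexp (h *\<^sub>R (L + diag_mat v))"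
    by (simp add: mexp_eq_exp D_def Q_def plus_sqmat.abs_eq scaleR_add_right add.commute)
  ultimately show ?thesis
    by (simp add: pow e[abs_def])
qed

section \<open>Left kernel vectors and positivity of exponentials\<close>

text \<open>A Perron-Frobenius argument. \<open>A\<close> is singular, so some
  \<open>x \<noteq> 0\<close> satisfies \<open>x v* A = 0\<close>. Replacing \<open>x\<close> by its
  entrywise absolute value makes every component of the product nonnegative, by the triangle
  inequality on the off-diagonal terms and the sign of the diagonal. Pairing this product with the
  positive vector \<open>u\<close> gives 0 because \<open>A *v u = 0\<close>, so the product
  vanishes.\<close>

lemma left_kernel_vector:
  fixes A :: "real^'n^'n"
  assumes off: "\<And>i j. i \<noteq> j \<Longrightarrow> 0 \<le> A $ i $ j"
    and A: "A *v u = 0" and u: "\<And>i. 0 < u $ i"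
  shows "\<exists>\<eta>. (\<forall>i. 0 \<le> \<eta> $ i) \<and> \<eta> v* A = 0 \<and> (\<Sum>i\<in>UNIV. \<eta> $ i * u $ i) = 1"
proof -
  have u': "0 \<le> u $ i" for i using u[of i] by simp
  have "u \<noteq> 0" using u by (metis less_irrefl zero_index)
  then have "rank (transpose A) \<noteq> CARD('n)"
    using A matrix_nonfull_linear_equations_eq[of A] by (auto simp: rank_transpose)
  then obtain x where "x \<noteq> 0" and "transpose A *v x = 0"
    using matrix_nonfull_linear_equations_eq[of "transpose A"] by blast
  then have x: "(\<Sum>i\<in>UNIV. x $ i * A $ i $ j) = 0" for j
    by (simp add: vec_eq_iff matrix_vector_mult_def transpose_def mult.commute)
  \<comment> \<open>In row \<open>j\<close> of \<open>A *v u = 0\<close> the off-diagonal part is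
    nonnegative, so the diagonal part cannot be positive.\<close>
  have diag: "A $ j $ j \<le> 0" for j
  proof -
    have "A $ j $ j * u $ j + (\<Sum>i\<in>UNIV - {j}. A $ j $ i * u $ i) = (A *v u) $ j"
      by (simp add: matrix_vector_mult_def sum.remove[of UNIV j])
    moreover have "0 \<le> (\<Sum>i\<in>UNIV - {j}. A $ j $ i * u $ i)"
      using u by (intro sum_nonneg mult_nonneg_nonneg off) (auto intro: less_imp_le)
    ultimately have "A $ j $ j * u $ j \<le> 0" using A by simp
    then show ?thesis using u[of j] by (simp add: mult_le_0_iff)
  qed
  define c where "c j = (\<Sum>i\<in>UNIV. \<bar>x $ i\<bar> * A $ i $ j)" for j
  have c: "0 \<le> c j" for j
  proof -
    have "\<bar>x $ j * A $ j $ j\<bar> = \<bar>\<Sum>i\<in>UNIV - {j}. x $ i * A $ i $ j\<bar>"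
      using x[of j] by (simp add: sum.remove[of UNIV j] eq_neg_iff_add_eq_0[symmetric])
    also have "\<dots> \<le> (\<Sum>i\<in>UNIV - {j}. \<bar>x $ i\<bar> * A $ i $ j)"
      using off by (intro order_trans[OF sum_abs] sum_mono) (auto simp: abs_mult)
    finally show ?thesis
      using diag[of j] by (simp add: c_def sum.remove[of UNIV j] abs_mult)
  qed
  have "(\<Sum>j\<in>UNIV. c j * u $ j) = (\<Sum>i\<in>UNIV. \<bar>x $ i\<bar> * (A *v u) $ i)"
    unfolding c_def matrix_vector_mult_def sum_distrib_right sum_distrib_left vec_lambda_beta
    by (subst sum.swap) (simp add: mult.assoc)
  then have "(\<Sum>j\<in>UNIV. c j * u $ j) = 0" using A by simp
  then have "\<forall>j. c j * u $ j = 0"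
    using c u by (subst (asm) sum_nonneg_eq_0_iff) (auto intro: mult_nonneg_nonneg less_imp_le)
  then have c0: "c j = 0" for j
    using u[of j] by (metis less_irrefl mult_eq_0_iff)
  define S where "S = (\<Sum>i\<in>UNIV. \<bar>x $ i\<bar> * u $ i)"
  have "S \<noteq> 0"
  proof
    assume "S = 0"
    then have "\<forall>i. \<bar>x $ i\<bar> * u $ i = 0"
      unfolding S_def by (subst (asm) sum_nonneg_eq_0_iff) (auto simp: u')
    then have "x $ i = 0" for i
      using u[of i] by (metis abs_eq_0 less_irrefl mult_eq_0_iff)
    with \<open>x \<noteq> 0\<close> show False by (simp add: vec_eq_iff)
  qed
  moreover have "0 \<le> S"
    unfolding S_def using u by (intro sum_nonneg mult_nonneg_nonneg) (auto intro: less_imp_le)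
  ultimately have S: "0 < S" by simp
  show ?thesis
  proof (intro exI[of _ "\<chi> i. \<bar>x $ i\<bar> / S"] conjI allI)
    have "(\<Sum>i\<in>UNIV. \<bar>x $ i\<bar> / S * A $ i $ j) = c j / S" for j
      by (simp add: c_def sum_divide_distrib)
    then show "(\<chi> i. \<bar>x $ i\<bar> / S) v* A = 0"
      by (simp add: vector_matrix_mult_def vec_eq_iff c0 mult.commute)
    have "(\<Sum>i\<in>UNIV. \<bar>x $ i\<bar> / S * u $ i) = S / S"
      by (simp only: S_def sum_divide_distrib times_divide_eq_left)
    then show "(\<Sum>i\<in>UNIV. (\<chi> i. \<bar>x $ i\<bar> / S) $ i * u $ i) = 1"
      using S by simp
  qed (use S in auto)
qed

lemma bounded_fun_finite:
  fixes f :: "'n::finite \<Rightarrow> real"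
  obtains C where "0 < C" "\<And>i. \<bar>f i\<bar> \<le> C"
proof
  have le: "\<bar>f i\<bar> \<le> Max (range (\<lambda>i. \<bar>f i\<bar>))" for i
    by (rule Max_ge) auto
  show "0 < 1 + Max (range (\<lambda>i. \<bar>f i\<bar>))" 
    using le[of undefined] by linarith
  show "\<bar>f i\<bar> \<le> 1 + Max (range (\<lambda>i. \<bar>f i\<bar>))" for i
    using le[of i] by linarith
qed

text \<open>Adding a large multiple \<open>k\<close> of the identity makes all entries nonnegative,
  and then every term of the series is nonnegative. Multiples of the identity commute with
  everything, so removing \<open>k\<close> again only multiplies by a positive diagonal
  matrix.\<close>

lemma mexp_nonneg:
  fixes A :: "real^'n^'n"
  assumes "\<And>i j. i \<noteq> j \<Longrightarrow> 0 \<le> A $ i $ j"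
  shows "0 \<le> mexp A $ i $ j"
proof -
  obtain k where k: "\<And>i. \<bar>A $ i $ i\<bar> \<le> k"
    using bounded_fun_finite[of "\<lambda>i. A $ i $ i"] by blast
  define B where "B = A + diag_mat (\<chi> i. k)"
  define D :: "real^'n^'n" where "D = diag_mat (\<chi> i. - k)"
  have B: "0 \<le> B $ i $ j" for i j
    using assms[of i j] k[of i] by (cases "i = j") (auto simp: B_def diag_mat_def abs_le_iff)
  have pow: "0 \<le> (((**) B) ^^ m) (mat 1) $ i $ j" for m i j
    by (induction m arbitrary: i j) 
      (auto simp: mat_def matrix_matrix_mult_def intro!: sum_nonneg mult_nonneg_nonneg B)
  have posB: "0 \<le> mexp B $ i $ j" for i j
    using sums_le[OF _ sums_zero mexp_sums[OF bounded_linear_entry, of B i j]] pow by simp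
  have "A = B + D"
    by (simp add: B_def D_def diag_mat_def vec_eq_iff)
  moreover have "sqmat_of B * sqmat_of D = sqmat_of D * sqmat_of B"
    by (simp add: times_sqmat.abs_eq sqmat_of_inject D_def diag_mat_def matrix_matrix_mult_def vec_eq_iff 
      if_distrib[of "\<lambda>x. x * _"] if_distrib[of "\<lambda>x. _ * x"] mult.commute cong: if_cong)
  ultimately have "mexp A = mexp B ** mexp D"
    by (simp add: mexp_eq_exp exp_add_commuting flip: plus_sqmat.abs_eq times_sqmat.rep_eq)
  moreover have "0 \<le> mexp D $ i $ j" for i j
    by (simp add: D_def mexp_diag_mat) (simp add: diag_mat_def)
  ultimately show ?thesis
    by (simp add: matrix_matrix_mult_def posB sum_nonneg)
qed

lemma linear_diag_mul: "linear (diag_mul f)"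
  by (intro linearI) (simp_all add: diag_mul_def vec_eq_iff distrib_left)

lemma diag_mul_axis: "diag_mul f (axis a 1) = f a *\<^sub>R axis a 1"
  by (simp add: diag_mul_def vec_eq_iff axis_def)

lemma vec_expand_axis: "u = (\<Sum>i\<in>UNIV. u $ i *\<^sub>R axis i (1::real))"
  by (simp add: vec_eq_iff axis_def if_distrib cong: if_cong)

lemma matrix_mult_axis_nth: "((A :: real^'n^'m) *v axis j 1) $ i = A $ i $ j"
  by (simp add: matrix_vector_mult_basis column_def)

section \<open>Path space\<close>

lemma paths_iff:
  "w \<in> paths \<longleftrightarrow> w \<in> extensional {0..} \<and> (\<forall>t\<ge>0. \<forall>\<^sub>F s in at_right t. w s = w t) \<and>
     (\<forall>t>0. \<exists>a. \<forall>\<^sub>F s in at_left t. w s = a)"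
proof -
  have "limitin (discrete_topology UNIV) w a F \<longleftrightarrow> (\<forall>\<^sub>F s in F. w s = a)" for a F
    unfolding limitin_def by (auto elim: eventually_mono dest!: spec[of _ "{a}"])
  then show ?thesis by (simp add: paths_def)
qed

lemma space_path_space [simp]: "space path_space = paths"
  unfolding path_space_def by (rule space_measure_of) auto

lemma measurable_eval [measurable]:
  assumes "0 \<le> t"
  shows "(\<lambda>w. w t) \<in> measurable path_space (count_space (UNIV :: 'n::countable set))"
proof (rule measurableI)
  fix A :: "'n set"
  have "{w \<in> paths. w t \<in> A} \<in> sets path_space"
    unfolding path_space_def using assms by (subst sets_measure_of) auto
  then show "(\<lambda>w. w t) -` A \<inter> space path_space \<in> sets path_space"
    by (simp add: vimage_def Int_def conj_commute)
qed auto

lemma measurable_eval_real: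
  assumes "0 \<le> t"
  shows "(\<lambda>w. f (w t) :: real) \<in> borel_measurable (path_space :: (real \<Rightarrow> 'n::finite) measure)"
  using measurable_compose[OF measurable_eval[OF assms], of f borel] by simp

lemma measurable_into_path_space:
  assumes "f \<in> space M \<rightarrow> paths" 
    and "\<And>t. 0 \<le> t \<Longrightarrow> (\<lambda>x. f x t) \<in> measurable M (count_space (UNIV :: 'n::countable set))"
  shows "f \<in> measurable M path_space"
  unfolding path_space_def
proof (rule measurable_measure_of)
  fix Y :: "(real \<Rightarrow> 'n) set" assume "Y \<in> {{w \<in> paths. w t \<in> A} |t A. 0 \<le> t}"
  then obtain t A where Y: "Y = {w \<in> paths. w t \<in> A}" and "0 \<le> t" by blast
  then have "f -` Y \<inter> space M = (\<lambda>x. f x t) -` A \<inter> space M"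
    using assms(1) by auto
  then show "f -` Y \<inter> space M \<in> sets M"
    using measurable_sets[OF assms(2)[OF \<open>0 \<le> t\<close>], of A] by simp
qed (use assms in auto)

lemma shift_apply: "0 \<le> r \<Longrightarrow> shift s w r = w (r + s)"
  by (simp add: shift_def)

lemma shift_in_paths:
  assumes w: "w \<in> paths" and s: "0 \<le> s"
  shows "shift s w \<in> paths"
  unfolding paths_iff
proof (intro conjI allI impI)
  show "shift s w \<in> extensional {0..}" by (simp add: shift_def)
next
  fix t :: real assume t: "0 \<le> t"
  then have "\<forall>\<^sub>F r in at_right (t + s). w r = w (t + s)"
    using w s by (simp add: paths_iff)
  then have "\<forall>\<^sub>F r in at_right t. w (r + s) = w (t + s)"
    by (simp add: at_right_to_0[of t] at_right_to_0[of "t + s"] eventually_filtermap add.assoc)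
  moreover have "\<forall>\<^sub>F r in at_right t. t < r"
    by (simp add: eventually_at_right_less)
  ultimately show "\<forall>\<^sub>F r in at_right t. shift s w r = shift s w t"
    by eventually_elim (use t in \<open>simp add: shift_apply\<close>)
next
  fix t :: real assume t: "0 < t"
  then obtain a where "\<forall>\<^sub>F r in at_left (t + s). w r = a"
    using w s unfolding paths_iff by (metis add_pos_nonneg)
  then have "\<forall>\<^sub>F r in at_left t. w (r + s) = a"
    by (simp add: eventually_at_left_field) (metis add_less_cancel_right diff_less_eq less_diff_eq)
  moreover have "\<forall>\<^sub>F r in at_left t. r \<in> {0<..<t}"
    by (rule eventually_at_leftI[of 0]) (use t in auto)
  ultimately have "\<forall>\<^sub>F r in at_left t. shift s w r = a"
    by eventually_elim (simp add: shift_apply)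
  then show "\<exists>a. \<forall>\<^sub>F r in at_left t. shift s w r = a" ..
qed

text \<open>Serves as a frozen future with prescribed terminal state: observables up to the freezing
  time see only its value at 0.\<close>

definition const_path :: "'n \<Rightarrow> real \<Rightarrow> 'n" where
  "const_path c = restrict (\<lambda>_. c) {0..}"

lemma const_path_apply [simp]: "0 \<le> t \<Longrightarrow> const_path c t = c"
  by (simp add: const_path_def)

lemma const_path_in_paths [simp]: "const_path c \<in> paths"
  unfolding paths_iff
proof (intro conjI allI impI)
  fix t :: real assume t: "0 \<le> t"
  have "\<forall>\<^sub>F r in at_right t. t < r"
    by (simp add: eventually_at_right_less)
  then show "\<forall>\<^sub>F r in at_right t. const_path c r = const_path c t"
    by eventually_elim (use t in simp)
next
  fix t :: real assume t: "0 < t"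
  have "\<forall>\<^sub>F r in at_left t. r \<in> {0<..<t}"
    by (rule eventually_at_leftI[of 0]) (use t in auto)
  then have "\<forall>\<^sub>F r in at_left t. const_path c r = c"
    by eventually_elim simp
  then show "\<exists>a. \<forall>\<^sub>F r in at_left t. const_path c r = a" ..
qed (simp add: const_path_def)

subsection \<open>Riemann sums along a path\<close>

text \<open>Half-open intervals make consecutive integrals add without overlap and match the cells
  of the right-endpoint sums below.\<close>

definition path_int :: "('n \<Rightarrow> real) \<Rightarrow> real \<Rightarrow> real \<Rightarrow> (real \<Rightarrow> 'n) \<Rightarrow> real" where
  "path_int f a b w = (LBINT s:{a<..b}. f (w s))"

text \<open>Right endpoints are chosen because the paths are right-continuous.\<close>

definition riemann_sum :: "('n \<Rightarrow> real) \<Rightarrow> real \<Rightarrow> real \<Rightarrow> (real \<Rightarrow> 'n) \<Rightarrow> nat \<Rightarrow> real" where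
  "riemann_sum f a b w n = (\<Sum>i<n. (b - a) / real n * f (w (a + real (Suc i) * ((b - a) / real n))))"

definition step_approx :: "('n \<Rightarrow> real) \<Rightarrow> real \<Rightarrow> real \<Rightarrow> (real \<Rightarrow> 'n) \<Rightarrow> nat \<Rightarrow> real \<Rightarrow> real" where
  "step_approx f a b w n r = (\<Sum>i<n. indicator {a + real i * ((b - a) / real n)<..a + real (Suc i) * ((b - a) / real n)} r *
      f (w (a + real (Suc i) * ((b - a) / real n))))"

text \<open>\<open>q\<close> is the right endpoint of the cell containing \<open>r\<close>, so it
  lies within one mesh width to the right of \<open>r\<close>, where right-continuity gives
  control.\<close>

lemma step_approx_value:
  assumes "a < r" "r \<le> b" "0 < n"
  obtains q where "r \<le> q" "q < r + (b - a) / real n" "step_approx f a b w n r = f (w q)"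
proof -
  define h where "h = (b - a) / real n"
  have h: "0 < h" using assms by (simp add: h_def)
  \<comment> \<open>Cells are open on the left, so the ceiling numbers the right endpoint and the
    cell index is one less.\<close>
  define k where "k = \<lceil>(r - a) / h\<rceil>"
  have k: "of_int k - 1 < (r - a) / h" "(r - a) / h \<le> of_int k"
    by (simp_all add: k_def) linarith
  have "0 < (r - a) / h" using assms h by simp
  with k have k1: "1 \<le> k" by linarith
  define i where "i = nat (k - 1)"
  have i: "real i = of_int k - 1" using k1 by (simp add: i_def)
  have lo: "a + real i * h < r" and hi: "r \<le> a + real (Suc i) * h"
    using k h i by (simp_all add: pos_less_divide_eq pos_divide_le_eq)
  have "real i * h < real n * h"
    using lo assms by (simp add: h_def)
  then have "i < n" using h by simp
  have other: "indicator {a + real j * h<..a + real (Suc j) * h} r = (0::real)" if "j \<noteq> i" for j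
  proof (cases "j < i")
    case True
    then have "real (Suc j) * h \<le> real i * h"
      using h by (intro mult_right_mono) auto
    then show ?thesis using lo by simp
  next
    case False
    with that have "real (Suc i) * h \<le> real j * h"
      using h by (intro mult_right_mono) auto
    then show ?thesis using hi by simp
  qed
  have "step_approx f a b w n r = f (w (a + real (Suc i) * h))"
    unfolding step_approx_def h_def[symmetric]
    using \<open>i < n\<close> lo hi other by (subst sum.remove[of _ i]) (auto intro!: sum.neutral)
  moreover have "a + real (Suc i) * h < r + h"
    using lo by (simp add: algebra_simps)
  ultimately show ?thesis using that hi unfolding h_def by blast
qed

lemma step_approx_outside:
  assumes "r \<notin> {a<..b}" "a \<le> b"
  shows "step_approx f a b w n r = 0"
proof (cases "n = 0")
  case False
  define h where "h = (b - a) / real n"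
  have "0 \<le> h" using assms by (simp add: h_def)
  have "indicator {a + real i * h<..a + real (Suc i) * h} r = (0::real)" if "i < n" for i
  proof -
    have "real (Suc i) * h \<le> real n * h" "0 \<le> real i * h"
      using that \<open>0 \<le> h\<close> by (auto intro!: mult_right_mono)
    moreover have "real n * h = b - a" using False by (simp add: h_def)
    ultimately show ?thesis using assms by auto
  qed
  then show ?thesis unfolding step_approx_def h_def[symmetric] by simp
qed (simp add: step_approx_def)

text \<open>The path is constant on some interval to the right of \<open>r\<close>; once the mesh is
  shorter than that interval, the approximation at \<open>r\<close> is exact.\<close>

lemma step_approx_tendsto:
  assumes "w \<in> paths" "0 \<le> a" "a \<le> b"
  shows "(\<lambda>n. step_approx f a b w n r) \<longlonglongrightarrow> indicator {a<..b} r * f (w r)"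
proof (cases "r \<in> {a<..b}")
  case True
  then have "\<forall>\<^sub>F s in at_right r. w s = w r"
    using assms by (simp add: paths_iff)
  then obtain c where c: "r < c" "\<And>s. r < s \<Longrightarrow> s < c \<Longrightarrow> w s = w r"
    unfolding eventually_at_right_field by blast
  define d where "d = c - r"
  have d: "0 < d" "\<And>s. r < s \<Longrightarrow> s < r + d \<Longrightarrow> w s = w r"
    using c by (auto simp: d_def)
  have "(\<lambda>n. (b - a) / real n) \<longlonglongrightarrow> 0"
    by (rule lim_const_over_n)
  then have "\<forall>\<^sub>F n in sequentially. (b - a) / real n < d"
    using d(1) by (rule order_tendstoD)
  then have "\<forall>\<^sub>F n in sequentially. step_approx f a b w n r = f (w r)"
    using eventually_gt_at_top[of 0]
  proof eventually_elim
    case (elim n)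
    from step_approx_value[of a r b n f w] True elim 
    obtain q where "r \<le> q" "q < r + (b - a) / real n" and q: "step_approx f a b w n r = f (w q)"
      by auto
    then have "w q = w r" using d(2)[of q] elim by (cases "q = r") auto
    then show ?case using q by simp
  qed
  then show ?thesis using True by (simp add: tendsto_eventually)
next
  case False
  then show ?thesis using assms by (simp add: step_approx_outside)
qed

lemma emeasure_lborel_Ioc_finite: "emeasure lborel {a<..b::real} < \<infinity>"
  by (cases "a \<le> b") auto

text \<open>Dominated convergence for the step functions, with dominating function a constant on the
  interval. Measurability of the path in time also comes from this pointwise limit.\<close>

lemma
  fixes w :: "real \<Rightarrow> 'n::finite"
  assumes "w \<in> paths" "0 \<le> a" "a \<le> b"
  shows set_integrable_path: "set_integrable lborel {a<..b} (\<lambda>r. f (w r))"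
    and riemann_sum_tendsto: "riemann_sum f a b w \<longlonglongrightarrow> path_int f a b w"
proof -
  obtain C where C: "0 < C" "\<And>i. \<bar>f i\<bar> \<le> C"
    using bounded_fun_finite[of f] by blast
  have bound: "norm (step_approx f a b w n r) \<le> C * indicator {a<..b} r" for n r
  proof (cases "r \<in> {a<..b} \<and> 0 < n")
    case True
    then obtain q where "step_approx f a b w n r = f (w q)"
      using step_approx_value[of a r b n f w] by auto
    then show ?thesis using True C by simp
  next
    case False
    then show ?thesis
      using step_approx_outside[of r a b f w n] assms C by (auto simp: step_approx_def)
  qed
  have m: "step_approx f a b w n \<in> borel_measurable lborel" for n
    unfolding step_approx_def[abs_def] by measurable
  have lim: "AE r in lborel. (\<lambda>n. step_approx f a b w n r) \<longlonglongrightarrow> indicator {a<..b} r * f (w r)"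
    using step_approx_tendsto[OF assms] by simp
  have mf: "(\<lambda>r. indicator {a<..b} r * f (w r)) \<in> borel_measurable lborel"
    by (rule borel_measurable_LIMSEQ_real[OF step_approx_tendsto[OF assms] m])
  have ib: "integrable lborel (\<lambda>r. C * indicator {a<..b} r :: real)"
    by (intro integrable_mult_right integrable_real_indicator) (auto simp: emeasure_lborel_Ioc_finite[unfolded infinity_ennreal_def])
  note dom = mf m ib lim AE_I2[OF bound]
  show "set_integrable lborel {a<..b} (\<lambda>r. f (w r))"
    unfolding set_integrable_def using integrable_dominated_convergence[OF dom] by simp
  have "integral\<^sup>L lborel (step_approx f a b w n) = riemann_sum f a b w n" for n
  proof -
    have nn: "0 \<le> (b - a) / real n" using assms by simp
    have "integral\<^sup>L lborel (step_approx f a b w n) = (\<Sum>i<n. LINT r|lborel. 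
      indicator {a + real i * ((b - a) / real n)<..a + real (Suc i) * ((b - a) / real n)} r *
      f (w (a + real (Suc i) * ((b - a) / real n))))"
      unfolding step_approx_def
      by (intro Bochner_Integration.integral_sum integrable_mult_left integrable_real_indicator) 
        (auto simp: emeasure_lborel_Ioc_finite[unfolded infinity_ennreal_def])
    also have "\<dots> = riemann_sum f a b w n"
      unfolding riemann_sum_def
    proof (rule sum.cong)
      fix i assume "i \<in> {..<n}"
      have le: "a + real i * ((b - a) / real n) \<le> a + real (Suc i) * ((b - a) / real n)"
        using nn by (intro add_left_mono mult_right_mono) auto
      have gen: "(LINT r|lborel. indicator {x<..y} r * c) = (y - x) * c" if "x \<le> y" for x y c :: real
        using that by simp
      have len: "a + real (Suc i) * h - (a + real i * h) = h" for h
        by (simp add: algebra_simps)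
      show "(LINT r|lborel. 
        indicator {a + real i * ((b - a) / real n)<..a + real (Suc i) * ((b - a) / real n)} r *
        f (w (a + real (Suc i) * ((b - a) / real n)))) = 
        (b - a) / real n * f (w (a + real (Suc i) * ((b - a) / real n)))"
        by (simp only: gen[OF le] len)
    qed simp
    finally show ?thesis .
  qed
  then show "riemann_sum f a b w \<longlonglongrightarrow> path_int f a b w"
    using integral_dominated_convergence[OF dom] 
    by (simp add: path_int_def set_lebesgue_integral_def)
qed

lemma path_int_add:
  fixes w :: "real \<Rightarrow> 'n::finite"
  assumes "w \<in> paths" "0 \<le> a" "a \<le> b" "b \<le> c"
  shows "path_int f a c w = path_int f a b w + path_int f b c w"
proof -
  have "{a<..c} = {a<..b} \<union> {b<..c}" using assms by auto
  then show ?thesis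
    unfolding path_int_def
    using assms by (simp add: set_integral_Un set_integrable_path)
qed

text \<open>The left endpoint is a null set. This links the closed interval in
  \<open>normalized_op\<close> with \<open>path_int\<close>.\<close>

lemma path_int_closed:
  fixes w :: "real \<Rightarrow> 'n::finite"
  assumes "w \<in> paths" "0 \<le> a" "a \<le> b"
  shows "(LBINT r:{a..b}. f (w r)) = path_int f a b w"
proof -
  have "{a..b} = {a} \<union> {a<..b}" using assms by auto
  moreover have "set_integrable lborel {a} (\<lambda>r. f (w r))" "(LBINT r:{a}. f (w r)) = 0"
  proof -
    have "(\<lambda>r. indicator {a} r *\<^sub>R f (w r)) = (\<lambda>r. indicator {a} r * f (w a))"
      by (auto simp: indicator_def)
    then show "set_integrable lborel {a} (\<lambda>r. f (w r))" "(LBINT r:{a}. f (w r)) = 0"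
      unfolding set_integrable_def set_lebesgue_integral_def by simp_all
  qed
  ultimately show ?thesis
    using assms set_integral_Un[of "{a}" "{a<..b}" lborel "\<lambda>r. f (w r)"] 
    by (simp add: path_int_def set_integrable_path)
qed

lemma riemann_sum_bound:
  assumes "\<And>i. \<bar>f i\<bar> \<le> C" "a \<le> b" "0 \<le> C"
  shows "\<bar>riemann_sum f a b w n\<bar> \<le> C * (b - a)"
proof (cases "n = 0")
  case False
  have le: "\<bar>(b - a) / real n * f i\<bar> \<le> (b - a) / real n * C" for i
    unfolding abs_mult using assms by (intro mult_mono) auto
  have "\<bar>riemann_sum f a b w n\<bar> \<le> (\<Sum>i<n. (b - a) / real n * C)"
    unfolding riemann_sum_def
    by (intro order_trans[OF sum_abs] sum_mono le)
  then show ?thesis using False by (simp add: mult.commute)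
qed (use assms in \<open>simp add: riemann_sum_def\<close>)

lemma riemann_sum_measurable:
  assumes "0 \<le> a" "a \<le> b"
  shows "(\<lambda>w. riemann_sum f a b w n) \<in> borel_measurable (path_space :: (real \<Rightarrow> 'n::finite) measure)"
  unfolding riemann_sum_def using assms
  by (intro borel_measurable_sum borel_measurable_times borel_measurable_const measurable_eval_real) auto

text \<open>The path integral is a pointwise limit of finite combinations of coordinates, so joint
  measurability in time and path is never invoked.\<close>

lemma path_int_measurable:
  assumes "0 \<le> a" "a \<le> b"
  shows "path_int f a b \<in> borel_measurable (path_space :: (real \<Rightarrow> 'n::finite) measure)"
proof (rule borel_measurable_LIMSEQ_real)
  show "w \<in> space path_space \<Longrightarrow> (\<lambda>n. riemann_sum f a b w n) \<longlonglongrightarrow> path_int f a b w" 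
    for w :: "real \<Rightarrow> 'n"
    using riemann_sum_tendsto[of w] assms by simp
qed (rule riemann_sum_measurable[OF assms])

lemma path_int_bound:
  fixes w :: "real \<Rightarrow> 'n::finite"
  assumes "w \<in> paths" "0 \<le> a" "a \<le> b" "\<And>i. \<bar>f i\<bar> \<le> C"
  shows "\<bar>path_int f a b w\<bar> \<le> C * (b - a)"
proof (rule tendsto_upperbound)
  show "(\<lambda>n. \<bar>riemann_sum f a b w n\<bar>) \<longlonglongrightarrow> \<bar>path_int f a b w\<bar>"
    using riemann_sum_tendsto[OF assms(1-3)] by (rule tendsto_rabs)
  have "0 \<le> C" using assms(4) abs_ge_zero order_trans by blast
  then show "\<forall>\<^sub>F n in sequentially. \<bar>riemann_sum f a b w n\<bar> \<le> C * (b - a)"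
    using riemann_sum_bound[of f C a b w, OF assms(4,3)] by simp
qed simp


subsection \<open>Products of observables and cylinders\<close>

text \<open>These products contain the indicators of cylinders, are closed under concatenation, and
  have expectations that can be computed by successive linear maps.\<close>

definition obs :: "(real \<times> ('n \<Rightarrow> real)) list \<Rightarrow> (real \<Rightarrow> 'n) \<Rightarrow> real" where
  "obs xs w = prod_list (map (\<lambda>(s, f). f (w s)) xs)"

lemma obs_simps [simp]:
  "obs [] w = 1" "obs ((s, f) # xs) w = f (w s) * obs xs w" "obs (xs @ ys) w = obs xs w * obs ys w"
  by (simp_all add: obs_def)

text \<open>The inequalities are weak so that a further factor can be inserted at a time that
  already occurs, in particular at 0 or at the end of the interval.\<close>

fun chain :: "real \<Rightarrow> (real \<times> 'b) list \<Rightarrow> real \<Rightarrow> bool" where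
  "chain s [] t \<longleftrightarrow> s \<le> t"
| "chain s ((r, f) # xs) t \<longleftrightarrow> s \<le> r \<and> chain r xs t"

lemma chain_iff: 
  "chain s xs t \<longleftrightarrow> s \<le> t \<and> sorted (map fst xs) \<and> (\<forall>x\<in>set xs. s \<le> fst x \<and> fst x \<le> t)"
  by (induction s xs t rule: chain.induct) auto

lemma chain_le: "chain s xs t \<Longrightarrow> s \<le> t"
  by (simp add: chain_iff)

lemma chain_ge: "chain s xs t \<Longrightarrow> x \<in> set xs \<Longrightarrow> s \<le> fst x"
  by (simp add: chain_iff)

lemma chain_append: "chain s xs r \<Longrightarrow> chain r ys t \<Longrightarrow> chain s (xs @ ys) t"
  by (induction s xs r rule: chain.induct) (auto simp: chain_iff intro: order_trans)

lemma chain_extend: "chain s xs t \<Longrightarrow> t \<le> t' \<Longrightarrow> chain s xs t'"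
  by (auto simp: chain_iff)

lemma chain_shift: 
  "chain s xs t \<Longrightarrow> chain (s - c) (map (\<lambda>(r, f). (r - c, f)) xs) (t - c)"
  by (induction s xs t rule: chain.induct) auto

lemma obs_measurable:
  assumes "\<And>x. x \<in> set xs \<Longrightarrow> 0 \<le> fst x"
  shows "obs xs \<in> borel_measurable (path_space :: (real \<Rightarrow> 'n::finite) measure)"
  using assms
proof (induction xs)
  case (Cons x xs)
  obtain s f where "x = (s, f)" by (cases x)
  then have "0 \<le> s" using Cons.prems by force
  then show ?case using Cons \<open>x = (s, f)\<close> by (auto intro!: borel_measurable_times measurable_eval_real)
qed (simp add: obs_def[abs_def])

lemma obs_bounded: 
  fixes xs :: "(real \<times> ('n::finite \<Rightarrow> real)) list"
  obtains C where "0 < C" "\<And>w. \<bar>obs xs w\<bar> \<le> C"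
proof -
  have "\<exists>C>0. \<forall>w. \<bar>obs xs w\<bar> \<le> C"
  proof (induction xs)
    case (Cons x xs)
    then obtain C where C: "0 < C" "\<And>w. \<bar>obs xs w\<bar> \<le> C" by blast
    obtain s f where x: "x = (s, f)" by (cases x)
    obtain D where D: "0 < D" "\<And>i. \<bar>f i\<bar> \<le> D" using bounded_fun_finite[of f] by blast
    have "\<bar>obs (x # xs) w\<bar> \<le> D * C" for w
      using C D by (auto simp: x abs_mult intro!: mult_mono)
    then show ?case using C D by (intro exI[of _ "D * C"]) auto
  qed (auto intro!: exI[of _ 1])
  then show ?thesis using that by blast
qed

lemma integrable_bounded_path:
  fixes g :: "(real \<Rightarrow> 'n) \<Rightarrow> real"
  assumes "finite_measure M" "sets M = sets path_space" "g \<in> borel_measurable path_space"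
    and "\<And>w. w \<in> paths \<Longrightarrow> \<bar>g w\<bar> \<le> C"
  shows "integrable M g"
proof -
  interpret finite_measure M by fact
  have "space M = paths"
    using sets_eq_imp_space_eq[OF assms(2)] by simp
  then show ?thesis
    using assms by (intro integrable_const_bound[of _ C]) (auto simp: measurable_cong_sets[OF assms(2) refl])
qed

lemma obs_cong: "(\<And>x. x \<in> set xs \<Longrightarrow> w (fst x) = w' (fst x)) \<Longrightarrow> obs xs w = obs xs w'"
  unfolding obs_def by (metis (mono_tags, lifting) case_prod_unfold map_cong)

lemma obs_map_shift: "obs (map (\<lambda>(r, f). (r - c, f)) xs) w = obs xs (\<lambda>r. w (r - c))"
  by (induction xs) (auto simp: obs_def)

section \<open>Cylinder sets and uniqueness of path laws\<close>

definition cyl :: "(real \<times> 'n set) list \<Rightarrow> (real \<Rightarrow> 'n) set" where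
  "cyl xs = {w \<in> paths. \<forall>(s, B)\<in>set xs. w s \<in> B}"

definition cyls :: "(real \<Rightarrow> 'n) set set" where
  "cyls = {cyl xs | xs. \<forall>(s, B)\<in>set xs. 0 \<le> s}"

lemma Int_stable_cyls: "Int_stable cyls"
proof (rule Int_stableI)
  fix A B :: "(real \<Rightarrow> 'a) set" assume "A \<in> cyls" "B \<in> cyls"
  then obtain xs ys where "A = cyl xs" "B = cyl ys" 
    "\<forall>(s, B)\<in>set xs. 0 \<le> s" "\<forall>(s, B)\<in>set ys. 0 \<le> s"
    unfolding cyls_def by blast
  then have "A \<inter> B = cyl (xs @ ys)" "\<forall>(s, B)\<in>set (xs @ ys). 0 \<le> s"
    by (auto simp: cyl_def)
  then show "A \<inter> B \<in> cyls" unfolding cyls_def by blast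
qed

lemma cyls_subset: "cyls \<subseteq> Pow paths"
  by (auto simp: cyls_def cyl_def)

lemma paths_in_cyls: "paths \<in> cyls"
  unfolding cyls_def by (auto simp: cyl_def intro!: exI[of _ "[]"])

lemma sets_path_space: "sets (path_space :: (real \<Rightarrow> 'n::countable) measure) = sigma_sets paths cyls"
proof (intro antisym)
  have "{{w \<in> paths. w t \<in> A} |t A. 0 \<le> t} \<subseteq> (cyls :: (real \<Rightarrow> 'n) set set)"
  proof safe
    fix t :: real and A :: "'n set" assume "0 \<le> t"
    then show "{w \<in> paths. w t \<in> A} \<in> cyls"
      unfolding cyls_def by (auto simp: cyl_def intro!: exI[of _ "[(t, A)]"])
  qed
  note sub = sigma_sets_mono'[OF this, of paths]
  have "sets path_space = sigma_sets paths {{w \<in> (paths :: (real \<Rightarrow> 'n) set). w t \<in> A} |t A. 0 \<le> t}"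
    unfolding path_space_def by (rule sets_measure_of) auto
  then show "sets path_space \<subseteq> sigma_sets paths (cyls :: (real \<Rightarrow> 'n) set set)"
    using sub by simp
  have "cyl xs \<in> sets path_space" if "\<forall>(s, B)\<in>set xs. 0 \<le> s" for xs :: "(real \<times> 'n set) list"
    using that
  proof (induction xs)
    case Nil
    then show ?case using sets.top[of path_space] by (simp add: cyl_def)
  next
    case (Cons x xs)
    obtain s B where x: "x = (s, B)" by (cases x)
    have "cyl (x # xs) = ((\<lambda>w. w s) -` B \<inter> space path_space) \<inter> cyl xs"
      by (auto simp: cyl_def x)
    then show ?case
      using Cons by (auto simp: x intro!: sets.Int measurable_sets[OF measurable_eval, of s B, simplified])
  qed
  then have "(cyls :: (real \<Rightarrow> 'n) set set) \<subseteq> sets path_space"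
    unfolding cyls_def by blast
  then show "sigma_sets paths (cyls :: (real \<Rightarrow> 'n) set set) \<subseteq> sets path_space"
    using sets.sigma_sets_subset[of cyls path_space] by simp
qed

text \<open>Sorting the constraints by time yields a chain; constraints at the same time merely
  multiply their indicators. The end time is any bound for the finitely many times.\<close>

lemma cyl_indicator:
  assumes "A \<in> cyls"
  obtains xs t where "chain 0 xs t" "\<And>w. w \<in> paths \<Longrightarrow> indicator A w = obs xs w"
proof -
  from assms obtain ys where A: "A = cyl ys" and ys: "\<forall>(s, B)\<in>set ys. 0 \<le> s"
    unfolding cyls_def by blast
  define zs where "zs = sort_key fst ys"
  define xs where "xs = map (\<lambda>(s, B). (s, indicator B :: 'a \<Rightarrow> real)) zs"
  have "A = cyl zs" by (simp add: A cyl_def zs_def)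
  moreover have "w \<in> paths \<Longrightarrow> indicator (cyl zs) w = obs xs w" for w
  proof -
    have "(if \<forall>(s, B)\<in>set zs. w s \<in> B then 1 else 0) = obs xs w"
      unfolding xs_def by (induction zs) (auto simp: indicator_def split: if_splits)
    then show "w \<in> paths \<Longrightarrow> indicator (cyl zs) w = obs xs w"
      by (simp add: cyl_def indicator_def split: if_splits)
  qed
  moreover have "sorted (map fst xs)" and xs: "\<And>x. x \<in> set xs \<Longrightarrow> 0 \<le> fst x"
    using ys by (auto simp: xs_def zs_def comp_def case_prod_unfold)
  moreover have "\<exists>t\<ge>0. \<forall>x\<in>set xs. fst x \<le> t"
    by (rule exI[of _ "Max (insert 0 (fst ` set xs))"]) auto
  then obtain t where "0 \<le> t" "\<forall>x\<in>set xs. fst x \<le> t" by blast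
  ultimately show ?thesis
    using that[of xs t] by (auto simp: chain_iff)
qed

text \<open>Cylinders form an intersection-stable generator, and their indicators are chain
  observables, so equality on these expectations determines the law.\<close>

lemma path_measure_eqI:
  fixes M N :: "(real \<Rightarrow> 'n::finite) measure"
  assumes M: "prob_space M" "sets M = sets path_space" and N: "prob_space N" "sets N = sets path_space"
    and eq: "\<And>xs t. chain 0 xs t \<Longrightarrow> integral\<^sup>L M (obs xs) = integral\<^sup>L N (obs xs)"
  shows "M = N"
proof (rule measure_eqI_generator_eq[of cyls paths M N "\<lambda>_. paths"])
  interpret M: prob_space M by fact
  interpret N: prob_space N by fact
  have sp: "space M = paths" "space N = paths"
    using sets_eq_imp_space_eq[OF M(2)] sets_eq_imp_space_eq[OF N(2)] by simp_all
  show "emeasure M X = emeasure N X" if "X \<in> cyls" for X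
  proof -
    obtain xs t where xs: "chain 0 xs t" "\<And>w. w \<in> paths \<Longrightarrow> indicator X w = obs xs w"
      using cyl_indicator[OF \<open>X \<in> cyls\<close>] by blast
    have XP: "X \<inter> paths = X" using cyls_subset that by blast
    have "X \<in> sets path_space" using that by (auto simp: sets_path_space)
    moreover have "integral\<^sup>L M (obs xs) = integral\<^sup>L M (indicator X)" 
      "integral\<^sup>L N (obs xs) = integral\<^sup>L N (indicator X)"
      by (rule Bochner_Integration.integral_cong; simp add: sp xs(2))+
    ultimately have "measure M X = measure N X"
      using eq[OF xs(1)] XP by (simp add: sp)
    then show ?thesis by (simp add: M.emeasure_eq_measure N.emeasure_eq_measure)
  qed
  show "emeasure M paths \<noteq> \<infinity>" using M.emeasure_space_1 sp by simp
qed (auto simp: Int_stable_cyls cyls_subset M N sets_path_space paths_in_cyls)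

section \<open>The Feynman-Kac formula\<close>

text \<open>Matrix-product form of finite-dimensional distributions: a mass vector is propagated
  from \<open>s\<close> to \<open>t\<close> and weighted at each observation. \<open>E\<close> is a
  parameter because the same recursion serves the exponential of \<open>L\<close> and that of
  \<open>L\<close> plus the potential.\<close>

fun ev :: "(real \<Rightarrow> real^'n^'n) \<Rightarrow> real \<Rightarrow> real^'n \<Rightarrow> (real \<times> ('n \<Rightarrow> real)) list \<Rightarrow> real \<Rightarrow> real^'n" where
  "ev E s u [] t = E (t - s) *v u"
| "ev E s u ((r, f) # xs) t = ev E r (diag_mul f (E (r - s) *v u)) xs t"

lemma linear_ev: "linear (\<lambda>u. ev E s u xs t)"
proof (induction xs arbitrary: s)
  case (Cons x xs)
  obtain r f where x: "x = (r, f)" by (cases x)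
  have "linear ((\<lambda>u. ev E r u xs t) \<circ> (diag_mul f \<circ> (\<lambda>u. E (r - s) *v u)))"
    by (intro linear_compose Cons linear_diag_mul matrix_vector_mul_linear)
  then show ?case by (simp add: x comp_def)
qed (simp add: matrix_vector_mul_linear)

lemma ev_shift: "ev E (s - c) u (map (\<lambda>(r, f). (r - c, f)) xs) (t - c) = ev E s u xs t"
  by (induction xs arbitrary: s u) auto

text \<open>Requiring the law for all real times, not only nonnegative ones, frees
  \<open>mgroup_trans\<close> and \<open>ev_append\<close> from ordering hypotheses.\<close>

definition mgroup :: "(real \<Rightarrow> real^'n^'n) \<Rightarrow> bool" where
  "mgroup E \<longleftrightarrow> E 0 = mat 1 \<and> (\<forall>s t. E (s + t) = E s ** E t)"

lemma mgroup_mexp: "mgroup (\<lambda>h. mexp (h *\<^sub>R A))"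
  by (simp add: mgroup_def mexp_add)

lemma mgroup_trans: "mgroup E \<Longrightarrow> E (c - b) *v (E (b - a) *v u) = E (c - a) *v u"
proof -
  assume "mgroup E"
  then have "E (c - b + (b - a)) = E (c - b) ** E (b - a)"
    unfolding mgroup_def by blast
  then show ?thesis by (simp add: matrix_vector_mul_assoc)
qed

lemma ev_append:
  assumes "mgroup E"
  shows "ev E s u (xs @ ys) t = ev E r (ev E s u xs r) ys t"
proof (induction xs arbitrary: s u)
  case Nil
  show ?case by (cases ys) (auto simp: mgroup_trans[OF assms])
qed auto

section \<open>Expectations under a measure with frozen future\<close>

locale past_measure =
  fixes L :: "real^'n^'n" and p0 :: "real^'n" and t :: real and x :: "real \<Rightarrow> 'n" 
    and M :: "(real \<Rightarrow> 'n) measure"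
  assumes offdiag: "\<And>i j. i \<noteq> j \<Longrightarrow> 0 \<le> L $ i $ j"
    and p0_pos: "\<And>i. 0 < p0 $ i"
    and t_pos: "0 < t"
    and past: "is_past_measure L p0 t x M"
begin

abbreviation P :: "real \<Rightarrow> real^'n^'n" where "P h \<equiv> mexp (h *\<^sub>R L)"
abbreviation c :: 'n where "c \<equiv> x 0"

lemma sets_M: "sets M = sets path_space" and AE_future: "AE w in M. shift t w = x"
  using past unfolding is_past_measure_def by blast+

lemma space_M: "space M = paths"
  using sets_eq_imp_space_eq[OF sets_M] by simp

lemma P_nonneg: "0 \<le> h \<Longrightarrow> 0 \<le> P h $ i $ j"
  using offdiag by (intro mexp_nonneg) simp

text \<open>The weight of a prefix started from \<open>p0\<close>, without the last leg to
  \<open>x 0\<close> at time \<open>t\<close> and without the normalisation by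
  \<open>p0 $ x 0\<close>.\<close>

definition path_weight :: "(nat \<Rightarrow> real) \<Rightarrow> (nat \<Rightarrow> 'n) \<Rightarrow> nat \<Rightarrow> real" where
  "path_weight \<tau> a r = (\<Prod>k=1..r. P (\<tau> k - \<tau> (k - 1)) $ a k $ a (k - 1)) * p0 $ a 0"

lemma emeasure_prefix:
  assumes "\<tau> 0 = 0" "\<forall>k<r. \<tau> k < \<tau> (Suc k)" "\<tau> r < t"
  shows "emeasure M {w \<in> paths. \<forall>k\<le>r. w (\<tau> k) = a k} = 
    ennreal (1 / p0 $ c * (P (t - \<tau> r) $ c $ a r * path_weight \<tau> a r))"
  using past[unfolded is_past_measure_def, THEN conjunct2, THEN conjunct2, 
      THEN spec, THEN spec, THEN spec, THEN spec, THEN mp, of \<tau> r "Suc r" a] assms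
  by (simp add: path_weight_def mult.assoc)

text \<open>The cylinders fixing the state at time 0 are finitely many, cover the space, and have
  prescribed finite masses.\<close>

lemma finite_measure_M: "finite_measure M"
proof
  have "emeasure M (space M) = emeasure M (\<Union>b\<in>UNIV. {w \<in> paths. w 0 = b})"
    by (rule arg_cong[of _ _ "emeasure M"]) (auto simp: space_M)
  also have "\<dots> \<le> (\<Sum>b\<in>UNIV. emeasure M {w \<in> paths. w 0 = b})"
  proof (rule emeasure_subadditive_finite)
    show "(\<lambda>b. {w \<in> paths. w 0 = b}) ` UNIV \<subseteq> sets M"
      using measurable_sets[OF measurable_eval[of 0], of "{_}"]
      by (auto simp: sets_M vimage_def Int_def conj_commute)
  qed simp
  also have "\<dots> < \<infinity>"
    using emeasure_prefix[of "\<lambda>_. 0" 0 "\<lambda>_. b" for b] t_pos 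
    by (simp add: less_top[symmetric])
  finally show "emeasure M (space M) \<noteq> \<infinity>" by simp
qed

sublocale M: finite_measure M by (rule finite_measure_M)

lemma integrable_M:
  "g \<in> borel_measurable path_space \<Longrightarrow> (\<And>w. w \<in> paths \<Longrightarrow> \<bar>g w\<bar> \<le> C) \<Longrightarrow> integrable M g" 
  for g :: "_ \<Rightarrow> real"
  by (rule integrable_bounded_path[OF finite_measure_M sets_M])

lemma prefix_set: 
  fixes \<tau> :: "nat \<Rightarrow> real" and a :: "nat \<Rightarrow> 'n"
  assumes "\<forall>k\<le>r. 0 \<le> \<tau> k"
  shows "{w \<in> paths. \<forall>k\<le>r. w (\<tau> k) = a k} \<in> sets path_space"
proof -
  have "{w \<in> paths. \<forall>k\<le>r. w (\<tau> k) = a k} = cyl (map (\<lambda>k. (\<tau> k, {a k})) [0..<Suc r])"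
    by (auto simp: cyl_def)
  moreover have "\<dots> \<in> cyls"
    unfolding cyls_def using assms by (intro CollectI exI conjI) auto
  ultimately show ?thesis by (simp only: sets_path_space sigma_sets.Basic)
qed

text \<open>Here every observation time equals \<open>t\<close>, and almost surely the path is in
  state \<open>x 0\<close> at that time. The observable is therefore a constant, and
  \<open>ev\<close> multiplies the component at \<open>x 0\<close> by the same constant.\<close>

lemma obs_at_end:
  assumes "chain t ys t"
  shows "\<exists>K. (AE w in M. obs ys w = K) \<and> (\<forall>u. ev P t u ys t $ c = K * u $ c)"
  using assms
proof (induction ys)
  case (Cons y ys)
  then obtain f where y: "y = (t, f)" and ch: "chain t ys t"
    by (cases y) (auto simp: chain_iff)
  from Cons.IH[OF ch] obtain K where K: "AE w in M. obs ys w = K" "\<forall>u. ev P t u ys t $ c = K * u $ c"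
    by blast
  have "AE w in M. obs (y # ys) w = f c * K"
    using K(1) AE_future
  proof eventually_elim
    case (elim w)
    then have "w t = c" using shift_apply[of 0 t w] by simp
    with elim show ?case by (simp add: y)
  qed
  moreover have "\<forall>u. ev P t u (y # ys) t $ c = f c * K * u $ c"
    using K(2) by (simp add: y diag_mul_def)
  ultimately show ?case by blast
qed (auto intro!: exI[of _ 1])

text \<open>The defining masses are known for strictly increasing times before \<open>t\<close>,
  while chains may repeat times and reach \<open>t\<close>. The induction therefore carries a strict
  prefix: a repeated time gives a constant factor, the time \<open>t\<close> falls under
  \<open>obs_at_end\<close>, and a new time before \<open>t\<close> extends the prefix, with a sum
  over the state found there. Multiplication by \<open>p0 $ c\<close> clears the
  normalisation.\<close>

lemma prefix_expectation:
  assumes "\<tau> 0 = 0" "\<forall>k<r. \<tau> k < \<tau> (Suc k)" "\<tau> r < t" "chain (\<tau> r) ys t"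
  shows "p0 $ c * (LINT w|M. indicator {w \<in> paths. \<forall>k\<le>r. w (\<tau> k) = a k} w * obs ys w) =
    ev P (\<tau> r) (path_weight \<tau> a r *\<^sub>R axis (a r) 1) ys t $ c"
  using assms
proof (induction ys arbitrary: \<tau> a r)
  have mono: "\<tau> k \<le> \<tau> l" if "k \<le> l" "l \<le> r" "\<forall>k<r. \<tau> k < \<tau> (Suc k)" for \<tau> :: "nat \<Rightarrow> real" and k l r
    using that
  proof (induction l)
    case (Suc l)
    then have "\<tau> l < \<tau> (Suc l)" by simp
    moreover have "\<tau> k \<le> \<tau> l" if "k \<noteq> Suc l" using Suc that by simp
    ultimately show ?case by (cases "k = Suc l") simp_all
  qed simp
  have nn: "\<forall>k\<le>r. 0 \<le> \<tau> k" if "\<tau> 0 = 0" "\<forall>k<r. \<tau> k < \<tau> (Suc k)" for \<tau> :: "nat \<Rightarrow> real" and r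
    using mono[of 0 _ r \<tau>] that by auto
  {
    fix \<tau> :: "nat \<Rightarrow> real" and a :: "nat \<Rightarrow> 'n" and r :: nat
    assume \<tau>: "\<tau> 0 = 0" "\<forall>k<r. \<tau> k < \<tau> (Suc k)" "\<tau> r < t"
    have "0 \<le> P (\<tau> k - \<tau> (k - 1)) $ i $ j" if "k \<in> {1..r}" for k i j
      using mono[of "k - 1" k r \<tau>] that \<tau>(2) by (intro P_nonneg) simp
    then have "0 \<le> path_weight \<tau> a r"
      unfolding path_weight_def by (intro mult_nonneg_nonneg prod_nonneg less_imp_le[OF p0_pos]) auto
    then have "0 \<le> 1 / p0 $ c * (P (t - \<tau> r) $ c $ a r * path_weight \<tau> a r)"
      using \<tau>(3) p0_pos[of c] by (intro mult_nonneg_nonneg P_nonneg) auto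
    then have "measure M {w \<in> paths. \<forall>k\<le>r. w (\<tau> k) = a k} = 
       1 / p0 $ c * (P (t - \<tau> r) $ c $ a r * path_weight \<tau> a r)"
      unfolding measure_def emeasure_prefix[OF \<tau>] by (rule enn2real_ennreal)
    moreover have "{w \<in> paths. \<forall>k\<le>r. w (\<tau> k) = a k} \<inter> paths = {w \<in> paths. \<forall>k\<le>r. w (\<tau> k) = a k}"
      by auto
    ultimately have "p0 $ c * (LINT w|M. indicator {w \<in> paths. \<forall>k\<le>r. w (\<tau> k) = a k} w) =
       ev P (\<tau> r) (path_weight \<tau> a r *\<^sub>R axis (a r) 1) [] t $ c"
      using p0_pos[of c] by (simp add: space_M matrix_vector_mult_scaleR matrix_mult_axis_nth del: One_nat_def)
  } note base = this
  {
    case Nil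
    then show ?case by (simp only: obs_simps mult_1_right base)
  next
    case (Cons y ys)
    obtain s f where y: "y = (s, f)" by (cases y)
    let ?u = "path_weight \<tau> a r *\<^sub>R axis (a r) 1"
    let ?I = "\<lambda>(\<tau> :: nat \<Rightarrow> real) a (r :: nat). indicator {w \<in> paths. \<forall>k\<le>r. w (\<tau> k) = a k} :: _ \<Rightarrow> real"
    from Cons.prems have ch: "\<tau> r \<le> s" "chain s ys t" by (auto simp: y)
    then have "s \<le> t" by (auto dest: chain_le)
    then consider "s = \<tau> r" | "s = t" | "\<tau> r < s" "s < t" using ch by linarith
    then show ?case
    proof cases
      case 1
      have "(LINT w|M. ?I \<tau> a r w * obs (y # ys) w) = (LINT w|M. f (a r) * (?I \<tau> a r w * obs ys w))"
        by (rule Bochner_Integration.integral_cong) (auto simp: y 1 indicator_def)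
      then have "p0 $ c * (LINT w|M. ?I \<tau> a r w * obs (y # ys) w) = 
          f (a r) * (p0 $ c * (LINT w|M. ?I \<tau> a r w * obs ys w))"
        by simp
      also have "\<dots> = f (a r) * ev P (\<tau> r) ?u ys t $ c"
        using Cons.IH[OF Cons.prems(1-3), of a] ch 1 by simp
      also have "\<dots> = ev P (\<tau> r) ?u (y # ys) t $ c"
        by (simp add: y 1 linear_cmul[OF linear_ev] linear_cmul[OF linear_diag_mul] diag_mul_axis)
      finally show ?thesis .
    next
      case 2
      then have "chain t (y # ys) t" using ch by (simp add: y)
      from obs_at_end[OF this] obtain K where K: "AE w in M. obs (y # ys) w = K" 
        "\<forall>u. ev P t u (y # ys) t $ c = K * u $ c" by blast
      have obs_m: "obs (y # ys) \<in> borel_measurable M"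
        unfolding measurable_cong_sets[OF sets_M refl]
      proof (rule obs_measurable)
        show "0 \<le> fst z" if "z \<in> set (y # ys)" for z
          using chain_ge[OF \<open>chain t (y # ys) t\<close> that] t_pos by simp
      qed
      have ind_m: "?I \<tau> a r \<in> borel_measurable M"
        unfolding measurable_cong_sets[OF sets_M refl]
        by (intro borel_measurable_indicator prefix_set nn Cons.prems)
      have "(LINT w|M. ?I \<tau> a r w * obs (y # ys) w) = (LINT w|M. K * ?I \<tau> a r w)"
      proof (rule integral_cong_AE)
        show "(\<lambda>w. ?I \<tau> a r w * obs (y # ys) w) \<in> borel_measurable M" 
          "(\<lambda>w. K * ?I \<tau> a r w) \<in> borel_measurable M"
          by (intro borel_measurable_times borel_measurable_const ind_m obs_m)+
        show "AE w in M. ?I \<tau> a r w * obs (y # ys) w = K * ?I \<tau> a r w"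
          using K(1) by eventually_elim simp
      qed
      then have "p0 $ c * (LINT w|M. ?I \<tau> a r w * obs (y # ys) w) = 
          K * (p0 $ c * (LINT w|M. ?I \<tau> a r w))"
        by (simp only: integral_mult_right_zero mult.left_commute)
      also have "\<dots> = K * (P (t - \<tau> r) *v ?u) $ c"
        by (simp only: base[OF Cons.prems(1-3)] ev.simps)
      also have "\<dots> = ev P (\<tau> r) ?u (y # ys) t $ c"
        using K(2)[rule_format, of "P (t - \<tau> r) *v ?u"] by (simp add: y 2)
      finally show ?thesis .
    next
      case 3
      \<comment> \<open>The prefix is extended by the time \<open>s\<close> in state
        \<open>b\<close>. Each path satisfies the new constraint for exactly one \<open>b\<close>,
        which allows the factor \<open>f (w s)\<close> to be expanded as a sum.\<close>
      define \<tau>' where "\<tau>' = \<tau>(Suc r := s)"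
      define a' where "a' b = a(Suc r := b)" for b
      have \<tau>': "\<tau>' 0 = 0" "\<forall>k<Suc r. \<tau>' k < \<tau>' (Suc k)" "\<tau>' (Suc r) < t" "chain (\<tau>' (Suc r)) ys t"
        using Cons.prems ch 3 by (auto simp: \<tau>'_def less_Suc_eq)
      have weight: "path_weight \<tau>' (a' b) (Suc r) = P (s - \<tau> r) $ b $ a r * path_weight \<tau> a r" for b
      proof -
        have "(\<Prod>k=1..r. P (\<tau>' k - \<tau>' (k - 1)) $ a' b k $ a' b (k - 1)) = 
            (\<Prod>k=1..r. P (\<tau> k - \<tau> (k - 1)) $ a k $ a (k - 1))"
          by (rule prod.cong) (auto simp: \<tau>'_def a'_def)
        then show ?thesis
          by (simp add: path_weight_def) (simp add: \<tau>'_def a'_def)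
      qed
      have s0: "0 \<le> s" using nn[OF Cons.prems(1,2)] 3 by force
      have obs_m: "obs ys \<in> borel_measurable path_space"
        using chain_ge[OF ch(2)] s0 by (intro obs_measurable) (auto intro: order_trans)
      obtain C where "0 < C" and C: "\<And>w. \<bar>obs ys w\<bar> \<le> C" by (rule obs_bounded[of ys]) (rule that)
      have int: "integrable M (\<lambda>w. f b * (?I \<tau>' (a' b) (Suc r) w * obs ys w))" for b
      proof (intro integrable_mult_right integrable_M[of _ C])
        show "(\<lambda>w. ?I \<tau>' (a' b) (Suc r) w * obs ys w) \<in> borel_measurable path_space"
          by (intro borel_measurable_times obs_m borel_measurable_indicator prefix_set nn \<tau>'(1,2))
        show "\<bar>?I \<tau>' (a' b) (Suc r) w * obs ys w\<bar> \<le> C" for w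
          using C[of w] by (auto simp: indicator_def)
      qed
      have "?I \<tau> a r w * obs (y # ys) w = (\<Sum>b\<in>UNIV. f b * (?I \<tau>' (a' b) (Suc r) w * obs ys w))" 
        if "w \<in> paths" for w
      proof -
        have "?I \<tau>' (a' b) (Suc r) w = (if b = w s then ?I \<tau> a r w else 0)" for b
          using that by (auto simp: indicator_def \<tau>'_def a'_def le_Suc_eq)
        then show ?thesis by (simp add: y if_distrib[of "\<lambda>x. x * _"] if_distrib[of "\<lambda>x. _ * x"] cong: if_cong)
      qed
      then have "(LINT w|M. ?I \<tau> a r w * obs (y # ys) w) = 
          (LINT w|M. (\<Sum>b\<in>UNIV. f b * (?I \<tau>' (a' b) (Suc r) w * obs ys w)))"
        by (intro Bochner_Integration.integral_cong) (auto simp: space_M)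
      also have "\<dots> = (\<Sum>b\<in>UNIV. f b * (LINT w|M. ?I \<tau>' (a' b) (Suc r) w * obs ys w))"
        using int by (subst Bochner_Integration.integral_sum) auto
      finally have "p0 $ c * (LINT w|M. ?I \<tau> a r w * obs (y # ys) w) = 
          (\<Sum>b\<in>UNIV. f b * (p0 $ c * (LINT w|M. ?I \<tau>' (a' b) (Suc r) w * obs ys w)))"
        by (simp add: sum_distrib_left mult.left_commute)
      also have "\<dots> = (\<Sum>b\<in>UNIV. f b * ev P s ((P (s - \<tau> r) $ b $ a r * path_weight \<tau> a r) *\<^sub>R axis b 1) ys t $ c)"
      proof -
        have "\<tau>' (Suc r) = s" "a' b (Suc r) = b" for b
          by (simp_all add: \<tau>'_def a'_def)
        then show ?thesis by (simp only: Cons.IH[OF \<tau>'] weight)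
      qed
      also have "\<dots> = ev P s (\<Sum>b\<in>UNIV. f b *\<^sub>R (P (s - \<tau> r) $ b $ a r * path_weight \<tau> a r) *\<^sub>R axis b 1) ys t $ c"
        by (simp add: linear_sum[OF linear_ev] linear_cmul[OF linear_ev] mult.assoc)
      also have "(\<Sum>b\<in>UNIV. f b *\<^sub>R (P (s - \<tau> r) $ b $ a r * path_weight \<tau> a r) *\<^sub>R axis b 1) = 
          diag_mul f (P (s - \<tau> r) *v ?u)"
        by (subst vec_expand_axis[of "diag_mul f (P (s - \<tau> r) *v ?u)"]) 
          (simp add: diag_mul_def matrix_vector_mult_scaleR matrix_mult_axis_nth mult.commute)
      finally show ?thesis by (simp add: y)
    qed
  }
qed

text \<open>\<open>u\<close> is the unnormalised mass vector at time \<open>s\<close> under the weight \<open>Z\<close>. Quantifying over all later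
  observables makes the property stable under extension in time and under bounded limits, which is what
  turns Riemann sums into the Feynman-Kac weight.\<close>

definition good :: "real \<Rightarrow> ((real \<Rightarrow> 'n) \<Rightarrow> real) \<Rightarrow> real^'n \<Rightarrow> bool" where
  "good s Z u \<longleftrightarrow> Z \<in> borel_measurable path_space \<and> (\<exists>C. \<forall>w\<in>paths. \<bar>Z w\<bar> \<le> C) \<and>
     (\<forall>ys. chain s ys t \<longrightarrow> p0 $ c * (LINT w|M. Z w * obs ys w) = ev P s u ys t $ c)"

text \<open>The one-point prefixes at time 0 partition the paths by initial state, and their mass
  vectors add up to \<open>p0\<close>.\<close>

lemma good_start: "good 0 (\<lambda>_. 1) p0"
  unfolding good_def
proof (intro conjI allI impI)
  fix ys :: "(real \<times> ('n \<Rightarrow> real)) list" assume ys: "chain 0 ys t"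
  let ?I = "\<lambda>b. indicator {w \<in> paths. \<forall>k\<le>(0::nat). w 0 = b} :: _ \<Rightarrow> real"
  have obs_m: "obs ys \<in> borel_measurable path_space"
    using obs_measurable[of ys] chain_ge[OF ys] by force
  obtain C where "0 < C" and C: "\<And>w. \<bar>obs ys w\<bar> \<le> C" by (rule obs_bounded[of ys]) (rule that)
  have int: "integrable M (\<lambda>w. ?I b w * obs ys w)" for b
  proof (rule integrable_M[of _ C])
    show "(\<lambda>w. ?I b w * obs ys w) \<in> borel_measurable path_space"
      using prefix_set[of 0 "\<lambda>_. 0" "\<lambda>_. b"] by (intro borel_measurable_times obs_m) simp
    show "\<bar>?I b w * obs ys w\<bar> \<le> C" for w
      using C[of w] by (auto simp: indicator_def)
  qed
  have "1 * obs ys w = (\<Sum>b\<in>UNIV. ?I b w * obs ys w)" if "w \<in> paths" for w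
  proof -
    have "?I b w = (if b = w 0 then 1 else 0)" for b
      using that by (auto simp: indicator_def)
    then show ?thesis by (simp add: if_distrib[of "\<lambda>x. x * _"] cong: if_cong)
  qed
  then have "(LINT w|M. 1 * obs ys w) = (LINT w|M. (\<Sum>b\<in>UNIV. ?I b w * obs ys w))"
    by (intro Bochner_Integration.integral_cong) (simp_all add: space_M)
  also have "\<dots> = (\<Sum>b\<in>UNIV. (LINT w|M. ?I b w * obs ys w))"
    using int by (subst Bochner_Integration.integral_sum) auto
  finally have "p0 $ c * (LINT w|M. 1 * obs ys w) = (\<Sum>b\<in>UNIV. p0 $ c * (LINT w|M. ?I b w * obs ys w))"
    by (simp add: sum_distrib_left)
  also have "\<dots> = (\<Sum>b\<in>UNIV. ev P 0 (p0 $ b *\<^sub>R axis b 1) ys t $ c)"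
    using prefix_expectation[where \<tau> = "\<lambda>_. 0" and r = 0 and ys = ys and a = "\<lambda>_. b" for b] ys t_pos by (simp add: path_weight_def)
  also have "\<dots> = ev P 0 (\<Sum>b\<in>UNIV. p0 $ b *\<^sub>R axis b 1) ys t $ c"
    by (simp add: linear_sum[OF linear_ev])
  finally show "p0 $ c * (LINT w|M. 1 * obs ys w) = ev P 0 p0 ys t $ c"
    using vec_expand_axis[of p0] by simp
qed auto

lemma good_step:
  assumes "good s Z u" "0 \<le> s" "s \<le> r"
  shows "good r (\<lambda>w. Z w * f (w r)) (diag_mul f (P (r - s) *v u))"
  unfolding good_def
proof (intro conjI allI impI)
  show "(\<lambda>w. Z w * f (w r)) \<in> borel_measurable path_space"
    using assms by (intro borel_measurable_times measurable_eval_real) (auto simp: good_def)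
  obtain C where C: "\<And>w. w \<in> paths \<Longrightarrow> \<bar>Z w\<bar> \<le> C" using assms(1) unfolding good_def by blast
  obtain D where D: "0 < D" "\<And>i. \<bar>f i\<bar> \<le> D" using bounded_fun_finite[of f] by blast
  show "\<exists>C. \<forall>w\<in>paths. \<bar>Z w * f (w r)\<bar> \<le> C"
    using C D by (intro exI[of _ "C * D"] ballI) (auto simp: abs_mult intro!: mult_mono order_trans[OF abs_ge_zero C])
  fix ys :: "(real \<times> ('n \<Rightarrow> real)) list" assume "chain r ys t"
  then have "chain s ((r, f) # ys) t" using assms by simp
  then show "p0 $ c * (LINT w|M. Z w * f (w r) * obs ys w) = ev P r (diag_mul f (P (r - s) *v u)) ys t $ c"
    using assms(1) unfolding good_def by (fastforce simp: mult.assoc)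
qed

text \<open>Dominated convergence handles the integral; on the other side \<open>ev\<close> is
  linear in its starting vector, hence continuous.\<close>

lemma good_limit:
  assumes good: "\<And>n. good s (Z n) (u n)" and s: "0 \<le> s"
    and bound: "\<And>n w. w \<in> paths \<Longrightarrow> \<bar>Z n w\<bar> \<le> C"
    and lim: "\<And>w. w \<in> paths \<Longrightarrow> (\<lambda>n. Z n w) \<longlonglongrightarrow> Z' w" and u: "u \<longlonglongrightarrow> u'"
  shows "good s Z' u'"
  unfolding good_def
proof (intro conjI allI impI)
  have Zm: "Z n \<in> borel_measurable path_space" for n
    using good by (simp add: good_def)
  then show Z'm: "Z' \<in> borel_measurable path_space"
    using borel_measurable_LIMSEQ_real[of path_space Z Z'] lim by simp
  have "\<bar>Z' w\<bar> \<le> C" if "w \<in> paths" for w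
    using tendsto_upperbound[OF tendsto_rabs[OF lim[OF that]]] bound[OF that] by simp
  then show "\<exists>C. \<forall>w\<in>paths. \<bar>Z' w\<bar> \<le> C" by blast
  fix ys :: "(real \<times> ('n \<Rightarrow> real)) list" assume ys: "chain s ys t"
  have obs_m: "obs ys \<in> borel_measurable path_space"
    using obs_measurable[of ys] chain_ge[OF ys] s by force
  obtain D where "0 < D" and D: "\<And>w. \<bar>obs ys w\<bar> \<le> D" by (rule obs_bounded[of ys]) (rule that)
  have "(\<lambda>n. LINT w|M. Z n w * obs ys w) \<longlonglongrightarrow> (LINT w|M. Z' w * obs ys w)"
  proof (rule integral_dominated_convergence[where w = "\<lambda>_. C * D"])
    show "(\<lambda>w. Z' w * obs ys w) \<in> borel_measurable M" "\<And>n. (\<lambda>w. Z n w * obs ys w) \<in> borel_measurable M"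
      unfolding measurable_cong_sets[OF sets_M refl] by (intro borel_measurable_times Zm Z'm obs_m)+
    show "AE w in M. (\<lambda>n. Z n w * obs ys w) \<longlonglongrightarrow> Z' w * obs ys w"
      by (intro AE_I2 tendsto_mult_right) (auto simp: space_M lim)
    show "\<And>n. AE w in M. norm (Z n w * obs ys w) \<le> C * D"
      using D by (intro AE_I2) (auto simp: space_M abs_mult intro!: mult_mono bound order_trans[OF abs_ge_zero bound])
  qed simp
  then have "(\<lambda>n. p0 $ c * (LINT w|M. Z n w * obs ys w)) \<longlonglongrightarrow> p0 $ c * (LINT w|M. Z' w * obs ys w)"
    by (rule tendsto_mult_left)
  moreover have "(\<lambda>n. ev P s (u n) ys t $ c) \<longlonglongrightarrow> ev P s u' ys t $ c"
    by (intro tendsto_vec_nth bounded_linear.tendsto[OF _ u] linear_conv_bounded_linear[THEN iffD1] linear_ev)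
  ultimately show "p0 $ c * (LINT w|M. Z' w * obs ys w) = ev P s u' ys t $ c"
    using good ys unfolding good_def by (auto intro: LIMSEQ_unique)
qed

text \<open>The exponential of a Riemann sum is a product of one-time factors, so repeated use of
  \<open>good_step\<close> gives a Trotter product as mass vector. The limit of the Riemann sums and
  the Trotter limit are then taken together.\<close>

lemma good_exp_path_int:
  assumes Z: "good s Z u" and s: "0 \<le> s" "s \<le> r"
  shows "good r (\<lambda>w. Z w * exp (path_int (($) v) s r w)) (mexp ((r - s) *\<^sub>R (L + diag_mat v)) *v u)"
proof -
  define F where "F n = (\<lambda>u. diag_mul (\<lambda>i. exp ((r - s) / real n * v $ i)) (P ((r - s) / real n) *v u))" for n
  have partial: "good (s + real k * h) (\<lambda>w. Z w * exp (\<Sum>i<k. h * v $ w (s + real (Suc i) * h)))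
    (((\<lambda>u. diag_mul (\<lambda>i. exp (h * v $ i)) (P h *v u)) ^^ k) u)" if "0 \<le> h" for k h
  proof (induction k)
    case 0
    then show ?case using Z by simp
  next
    case (Suc k)
    have "good (s + real (Suc k) * h) 
      (\<lambda>w. Z w * exp (\<Sum>i<k. h * v $ w (s + real (Suc i) * h)) * exp (h * v $ w (s + real (Suc k) * h)))
      (diag_mul (\<lambda>i. exp (h * v $ i)) (P (s + real (Suc k) * h - (s + real k * h)) *v 
        (((\<lambda>u. diag_mul (\<lambda>i. exp (h * v $ i)) (P h *v u)) ^^ k) u)))"
      by (rule good_step[OF Suc]) (use s that in \<open>auto intro: mult_right_mono\<close>)
    moreover have "s + real (Suc k) * h - (s + real k * h) = h" by (simp add: algebra_simps)
    ultimately show ?case by (simp only: sum.lessThan_Suc exp_add mult.assoc funpow.simps comp_def)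
  qed
  \<comment> \<open>\<open>Suc n\<close> excludes the empty subdivision, whose partial product would
    end at \<open>s\<close> rather than at \<open>r\<close>.\<close>
  have riemann: "good r (\<lambda>w. Z w * exp (riemann_sum (($) v) s r w (Suc n))) ((F (Suc n) ^^ Suc n) u)" for n
  proof -
    have "s + real (Suc n) * ((r - s) / real (Suc n)) = r" by simp
    then show ?thesis
      using partial[of "(r - s) / real (Suc n)" "Suc n"] s 
      unfolding F_def riemann_sum_def by (simp del: funpow.simps of_nat_Suc)
  qed
  obtain C where C: "\<And>w. w \<in> paths \<Longrightarrow> \<bar>Z w\<bar> \<le> C" using Z unfolding good_def by blast
  obtain D where D: "0 < D" "\<And>i. \<bar>v $ i\<bar> \<le> D" using bounded_fun_finite[of "($) v"] by blast
  show ?thesis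
  proof (rule good_limit[OF riemann])
    show "0 \<le> r" using s by simp
    show "\<bar>Z w * exp (riemann_sum (($) v) s r w (Suc n))\<bar> \<le> C * exp (D * (r - s))" if "w \<in> paths" for n w
    proof -
      have "riemann_sum (($) v) s r w (Suc n) \<le> D * (r - s)"
        using riemann_sum_bound[of "($) v" D s r w "Suc n"] D s by auto
      then show ?thesis 
        using C[OF that] by (auto simp: abs_mult intro!: mult_mono)
    qed
    show "(\<lambda>n. Z w * exp (riemann_sum (($) v) s r w (Suc n))) \<longlonglongrightarrow> Z w * exp (path_int (($) v) s r w)" 
      if "w \<in> paths" for w
      by (intro tendsto_mult_left tendsto_exp LIMSEQ_Suc riemann_sum_tendsto that s)
    show "(\<lambda>n. (F (Suc n) ^^ Suc n) u) \<longlonglongrightarrow> mexp ((r - s) *\<^sub>R (L + diag_mat v)) *v u"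
      unfolding F_def by (rule LIMSEQ_Suc[OF Trotter_diag])
  qed
qed

text \<open>At each observation the exponential over the elapsed interval and the observed factor
  are absorbed into \<open>Z\<close>; additivity of the path integral leaves an exponential that
  starts at the observation time. With no observation left, \<open>good\<close> at time
  \<open>t\<close> is evaluated on the empty chain.\<close>

lemma Feynman_Kac:
  assumes "good s Z u" "0 \<le> s" "chain s xs t"
  shows "p0 $ c * (LINT w|M. Z w * obs xs w * exp (path_int (($) v) s t w)) = 
    ev (\<lambda>h. mexp (h *\<^sub>R (L + diag_mat v))) s u xs t $ c"
  using assms
proof (induction xs arbitrary: s Z u)
  case Nil
  then have "good t (\<lambda>w. Z w * exp (path_int (($) v) s t w)) (mexp ((t - s) *\<^sub>R (L + diag_mat v)) *v u)"
    by (intro good_exp_path_int) auto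
  then show ?case
    unfolding good_def by (auto dest!: spec[of _ "[]"])
next
  case (Cons y xs)
  obtain r f where y: "y = (r, f)" by (cases y)
  have ch: "s \<le> r" "chain r xs t" using Cons.prems by (auto simp: y)
  note r = good_step[OF good_exp_path_int[OF Cons.prems(1,2) ch(1), of v], of r f]
  have "p0 $ c * (LINT w|M. Z w * exp (path_int (($) v) s r w) * f (w r) * obs xs w * exp (path_int (($) v) r t w)) =
      ev (\<lambda>h. mexp (h *\<^sub>R (L + diag_mat v))) s u (y # xs) t $ c"
    using Cons.IH[OF r _ ch(2)] Cons.prems ch by (simp add: y)
  moreover have "(LINT w|M. Z w * exp (path_int (($) v) s r w) * f (w r) * obs xs w * exp (path_int (($) v) r t w)) =
     (LINT w|M. Z w * obs (y # xs) w * exp (path_int (($) v) s t w))"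
    using Cons.prems ch chain_le[OF ch(2)]
    by (intro Bochner_Integration.integral_cong) (auto simp: y space_M path_int_add[of _ s r t] exp_add)
  ultimately show ?case by simp
qed

end

section \<open>The normalised kernel\<close>

lemma
  fixes f :: "'b \<Rightarrow> real"
  assumes M: "prob_space M" and K: "K \<in> measurable M (prob_algebra B)"
    and f: "f \<in> borel_measurable B" "\<And>y. y \<in> space B \<Longrightarrow> \<bar>f y\<bar> \<le> C"
  shows integral_bind_prob: "integral\<^sup>L (M \<bind> K) f = (LINT x|M. integral\<^sup>L (K x) f)"
    and integrable_kernel_integral: "integrable M (\<lambda>x. integral\<^sup>L (K x) f)"
proof -
  interpret prob_space M by fact
  have K': "K \<in> measurable M (subprob_algebra B)"
    using K by (rule measurable_prob_algebraD)
  have Kx: "prob_space (K x)" "sets (K x) = sets B" if "x \<in> space M" for x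
    using measurable_space[OF K that] by (auto simp: space_prob_algebra)
  have "integral\<^sup>L (M \<bind> K) f = integral\<^sup>L (join (distr M (subprob_algebra B) K)) f"
    by (simp add: bind_nonempty''[OF K' not_empty])
  also have "\<dots> = (LINT N|distr M (subprob_algebra B) K. integral\<^sup>L N f)"
  proof (rule integral_join[OF f])
    show "finite_measure (distr M (subprob_algebra B) K)"
      by (rule finite_measure_distr[OF K'])
    show "AE N in distr M (subprob_algebra B) K. emeasure N (space N) \<le> ennreal 1"
      by (rule AE_I2) (auto simp: space_subprob_algebra intro: subprob_space.subprob_emeasure_le_1)
  qed auto
  also have "\<dots> = (LINT x|M. integral\<^sup>L (K x) f)"
    by (rule integral_distr[OF K' integral_measurable_subprob_algebra[OF f(1)]])
  finally show "integral\<^sup>L (M \<bind> K) f = (LINT x|M. integral\<^sup>L (K x) f)" .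
  show "integrable M (\<lambda>x. integral\<^sup>L (K x) f)"
  proof (rule integrable_const_bound[of _ C])
    show "(\<lambda>x. integral\<^sup>L (K x) f) \<in> borel_measurable M"
      by (rule measurable_compose[OF K' integral_measurable_subprob_algebra[OF f(1)]])
    show "AE x in M. norm (integral\<^sup>L (K x) f) \<le> C"
    proof (rule AE_I2)
      fix x assume x: "x \<in> space M"
      interpret Kx: prob_space "K x" by (rule Kx(1)[OF x])
      have sp: "space (K x) = space B" using sets_eq_imp_space_eq[OF Kx(2)[OF x]] .
      have "integrable (K x) f"
        using f Kx[OF x] sp by (intro Kx.integrable_const_bound[of _ C]) (auto simp: measurable_cong_sets[OF Kx(2)[OF x] refl])
      then have "\<bar>integral\<^sup>L (K x) f\<bar> \<le> (LINT y|K x. \<bar>f y\<bar>)"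
        using integral_norm_bound[of "K x" f] by simp
      also have "\<dots> \<le> C"
        using f(2) sp \<open>integrable (K x) f\<close> by (intro Kx.integral_le_const) auto
      finally show "norm (integral\<^sup>L (K x) f) \<le> C" by simp
    qed
  qed
qed

lemma chain_split:
  assumes "chain s zs T" "s \<le> t"
  obtains xs ys where "zs = xs @ ys" "chain s xs t" "\<forall>x\<in>set xs. fst x < t" "chain t ys (max t T)"
proof -
  have "\<exists>xs ys. zs = xs @ ys \<and> chain s xs t \<and> (\<forall>x\<in>set xs. fst x < t) \<and> chain t ys (max t T)"
    using assms
  proof (induction zs arbitrary: s)
    case (Cons z zs)
    obtain r f where z: "z = (r, f)" by (cases z)
    show ?case
    proof (cases "r < t")
      case True
      then obtain xs ys where "zs = xs @ ys" "chain r xs t" "\<forall>x\<in>set xs. fst x < t" "chain t ys (max t T)"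
        using Cons.IH[of r] Cons.prems z by auto
      then show ?thesis using Cons.prems True z
        by (intro exI[of _ "z # xs"] exI[of _ ys]) auto
    next
      case False
      then have "chain t (z # zs) (max t T)"
        using Cons.prems z by (auto intro: chain_extend)
      then show ?thesis using Cons.prems by (intro exI[of _ "[]"] exI[of _ "z # zs"]) auto
    qed
  qed auto
  then show ?thesis using that by blast
qed

text \<open>Here \<open>v\<close> is the potential after subtraction of the eigenvalue and
  \<open>u\<close> is the vector \<mu>_V.\<close>

locale twisted_kernel =
  fixes L :: "real^'n^'n" and p0 u v \<eta> :: "real^'n" 
    and \<mu> :: "real \<Rightarrow> (real \<Rightarrow> 'n) \<Rightarrow> (real \<Rightarrow> 'n) measure"
  assumes offdiag: "\<And>i j. i \<noteq> j \<Longrightarrow> 0 \<le> L $ i $ j"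
    and p0_pos: "\<And>i. 0 < p0 $ i"
    and past: "\<And>t x. 0 < t \<Longrightarrow> x \<in> paths \<Longrightarrow> is_past_measure L p0 t x (\<mu> t x)"
    and u_pos: "\<And>i. 0 < u $ i"
    and u_ker: "(L + diag_mat v) *v u = 0"
    and \<eta>_nonneg: "\<And>i. 0 \<le> \<eta> $ i"
    and \<eta>_ker: "\<eta> v* (L + diag_mat v) = 0"
    and \<eta>_u: "(\<Sum>i\<in>UNIV. \<eta> $ i * u $ i) = 1"
begin

definition E :: "real \<Rightarrow> real^'n^'n" where "E h = mexp (h *\<^sub>R (L + diag_mat v))"

lemma mgroup_E: "mgroup E"
  unfolding E_def by (rule mgroup_mexp)

lemma E_0 [simp]: "E 0 = mat 1"
  by (simp add: E_def)

lemma E_u [simp]: "E h *v u = u"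
  unfolding E_def using u_ker by (intro mexp_ker_right) (simp flip: scaleR_matrix_vector_assoc)

lemma \<eta>_E: "\<eta> \<bullet> (E h *v w) = \<eta> \<bullet> w"
proof -
  have "\<eta> v* (h *\<^sub>R (L + diag_mat v)) = h *\<^sub>R (\<eta> v* (L + diag_mat v))"
    by (rule linear_scale[OF bounded_linear.linear[OF bounded_linear_vector_matrix_right]])
  then have "\<eta> v* E h = \<eta>"
    unfolding E_def using \<eta>_ker by (intro mexp_ker_left) simp
  then show ?thesis by (metis dot_lmul_matrix)
qed

text \<open>Left invariance of \<eta> discards the stretch after the last observation. This is the
  consistency of the finite-dimensional distributions, and it permits any convenient end
  time.\<close>

lemma \<eta>_ev: "\<eta> \<bullet> ev E s w xs t = \<eta> \<bullet> ev E s w xs t'"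
  by (induction xs arbitrary: s w) (auto simp: \<eta>_E)

text \<open>If \<eta> is 0 at \<open>j\<close>, column \<open>j\<close> of
  \<open>\<eta> v* (L + diag_mat v) = 0\<close> is a vanishing sum of nonnegative terms, so no entry
  leads from \<open>j\<close> to a state where \<eta> is nonzero. Vectors supported on the zero
  states thus form a subspace invariant under the generator, its exponentials and all diagonal
  weights, and \<eta> annihilates that subspace.\<close>

lemma \<eta>_ev_axis_0:
  assumes "\<eta> $ b = 0"
  shows "\<eta> \<bullet> ev E s (axis b 1) xs t = 0"
proof -
  define W where "W = {w :: real^'n. \<forall>i. \<eta> $ i \<noteq> 0 \<longrightarrow> w $ i = 0}"
  have W: "subspace W"
    unfolding W_def subspace_def by (auto simp: distrib_left)
  have col: "\<eta> $ i * (L + diag_mat v) $ i $ j = 0" if j: "\<eta> $ j = 0" for i j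
  proof -
    have "(\<Sum>i\<in>UNIV. \<eta> $ i * (L + diag_mat v) $ i $ j) = 0"
      using \<eta>_ker by (simp add: vec_eq_iff vector_matrix_mult_def mult.commute)
    moreover have "0 \<le> \<eta> $ i * (L + diag_mat v) $ i $ j" for i
      using \<eta>_nonneg[of i] offdiag[of i j] j by (cases "i = j") (auto simp: diag_mat_def)
    ultimately show ?thesis by (simp add: sum_nonneg_eq_0_iff)
  qed
  have "(L + diag_mat v) *v w \<in> W" if w: "w \<in> W" for w
    unfolding W_def
  proof (intro CollectI allI impI)
    fix i assume i: "\<eta> $ i \<noteq> 0"
    have "\<eta> $ i * ((L + diag_mat v) $ i $ j * w $ j) = 0" for j
      using col[of j i] w by (cases "\<eta> $ j = 0") (auto simp: W_def)
    then have "((L + diag_mat v) $ i $ j) * w $ j = 0" for j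
      using i mult_eq_0_iff by blast
    then show "((L + diag_mat v) *v w) $ i = 0"
      unfolding matrix_vector_mult_def vec_lambda_beta by (intro sum.neutral ballI)
  qed
  then have E: "E h *v w \<in> W" if "w \<in> W" for h w
    unfolding E_def using that W
    by (intro mexp_invariant) (auto simp flip: scaleR_matrix_vector_assoc intro: subspace_scale)
  have D: "diag_mul f w \<in> W" if "w \<in> W" for f w
    using that by (auto simp: W_def diag_mul_def)
  have "ev E s w xs t \<in> W" if "w \<in> W" for w
    using that by (induction xs arbitrary: s w) (auto simp: E D)
  moreover have "axis b 1 \<in> W"
    using assms by (auto simp: W_def axis_def)
  ultimately have "ev E s (axis b 1) xs t \<in> W" by blast
  then show ?thesis unfolding inner_vec_def by (intro sum.neutral ballI) (auto simp: W_def)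
qed

text \<open>The exponential weight and both conjugating quotients of the normalised operator,
  gathered into one density; this is a Doob transform by \<open>u\<close>.\<close>

definition kernel_density :: "real \<Rightarrow> (real \<Rightarrow> 'n) \<Rightarrow> (real \<Rightarrow> 'n) \<Rightarrow> real" where
  "kernel_density t x w = p0 $ x 0 / u $ x 0 * (exp (path_int (($) v) 0 t w) * (u $ w 0 / p0 $ w 0))"

definition kernel :: "real \<Rightarrow> (real \<Rightarrow> 'n) \<Rightarrow> (real \<Rightarrow> 'n) measure" where
  "kernel t x = density (\<mu> t x) (\<lambda>w. ennreal (kernel_density t x w))"

lemma past_measureI: "0 < t \<Longrightarrow> x \<in> paths \<Longrightarrow> past_measure L p0 t x (\<mu> t x)"
  by unfold_locales (use offdiag p0_pos past in auto)

lemma kernel_density_measurable: "0 \<le> t \<Longrightarrow> kernel_density t x \<in> borel_measurable path_space"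
  unfolding kernel_density_def
  by (intro borel_measurable_times borel_measurable_exp borel_measurable_const path_int_measurable 
      measurable_compose[OF path_int_measurable] measurable_eval_real[of 0 "\<lambda>i. u $ i / p0 $ i"]) auto

lemma kernel_density_nonneg: "0 \<le> kernel_density t x w"
  unfolding kernel_density_def using u_pos p0_pos by (auto intro!: mult_nonneg_nonneg divide_nonneg_nonneg less_imp_le)

lemma kernel_density_bounded:
  assumes "0 \<le> t"
  obtains C where "\<And>w. w \<in> paths \<Longrightarrow> \<bar>kernel_density t x w\<bar> \<le> C"
proof -
  obtain D where D: "\<And>i. \<bar>v $ i\<bar> \<le> D" using bounded_fun_finite[of "($) v"] by metis
  obtain F where F: "0 < F" "\<And>i. \<bar>u $ i / p0 $ i\<bar> \<le> F" using bounded_fun_finite[of "\<lambda>i. u $ i / p0 $ i"] by metis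
  show ?thesis
  proof (rule that)
    fix w :: "real \<Rightarrow> 'n" assume w: "w \<in> paths"
    have "path_int (($) v) 0 t w \<le> D * t"
      using path_int_bound[OF w, of 0 t "($) v" D] D assms by auto
    then show "\<bar>kernel_density t x w\<bar> \<le> \<bar>p0 $ x 0 / u $ x 0\<bar> * (exp (D * t) * F)"
      unfolding kernel_density_def abs_mult[of "p0 $ x 0 / u $ x 0"] abs_mult[of "exp _"]
      using F by (intro mult_left_mono mult_mono) auto
  qed
qed

context
  fixes t :: real and x :: "real \<Rightarrow> 'n" assumes t: "0 < t" and x: "x \<in> paths"
begin

interpretation past_measure L p0 t x "\<mu> t x"
  by (rule past_measureI[OF t x])

lemma sets_kernel [simp]: "sets (kernel t x) = sets path_space"
  by (simp add: kernel_def sets_M)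

lemma space_kernel [simp]: "space (kernel t x) = paths"
  using sets_eq_imp_space_eq[OF sets_kernel] by simp

lemma integral_kernel:
  assumes g: "g \<in> borel_measurable path_space"
  shows "(LINT w|kernel t x. g w) = p0 $ x 0 / u $ x 0 * 
    (LINT w|\<mu> t x. exp (path_int (($) v) 0 t w) * (u $ w 0 / p0 $ w 0) * g w)"
proof -
  have "(LINT w|kernel t x. g w) = (LINT w|\<mu> t x. kernel_density t x w *\<^sub>R g w)"
    unfolding kernel_def using g kernel_density_measurable[of t x] t
    by (intro integral_density) (auto simp: measurable_cong_sets[OF sets_M refl] kernel_density_nonneg)
  also have "\<dots> = (LINT w|\<mu> t x. p0 $ x 0 / u $ x 0 * 
      (exp (path_int (($) v) 0 t w) * (u $ w 0 / p0 $ w 0) * g w))"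
    by (simp only: kernel_density_def real_scaleR_def mult.assoc)
  finally show ?thesis by (simp only: integral_mult_right_zero)
qed

text \<open>The quotient of \<open>u\<close> by \<open>p0\<close> at time 0 replaces the initial
  mass vector \<open>p0\<close> by \<open>u\<close>; the Feynman-Kac formula does the rest.\<close>

lemma integral_kernel_obs:
  assumes "chain 0 xs t"
  shows "(LINT w|kernel t x. obs xs w) = (ev E 0 u xs t) $ x 0 / u $ x 0"
proof -
  have "good 0 (\<lambda>w. 1 * (u $ w 0 / p0 $ w 0)) (diag_mul (\<lambda>i. u $ i / p0 $ i) (P (0 - 0) *v p0))"
    by (rule good_step[OF good_start]) auto
  moreover have "diag_mul (\<lambda>i. u $ i / p0 $ i) (P (0 - 0) *v p0) = u"
    using p0_pos by (simp add: diag_mul_def vec_eq_iff less_imp_neq[THEN not_sym])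
  ultimately have "good 0 (\<lambda>w. u $ w 0 / p0 $ w 0) u" by simp
  from Feynman_Kac[OF this order_refl assms, of v]
  have "p0 $ x 0 * (LINT w|\<mu> t x. u $ w 0 / p0 $ w 0 * obs xs w * exp (path_int (($) v) 0 t w)) = 
      ev E 0 u xs t $ x 0"
    by (simp add: E_def[abs_def])
  moreover have "obs xs \<in> borel_measurable path_space"
    using chain_ge[OF assms] by (rule obs_measurable)
  ultimately show ?thesis
    by (simp add: integral_kernel ac_simps)
qed

lemma AE_kernel_future: "AE w in kernel t x. shift t w = x"
  unfolding kernel_def using kernel_density_measurable[of t x] t AE_future
  by (subst AE_density) (auto simp: measurable_cong_sets[OF sets_M refl])

text \<open>With no observations the total mass is the ratio of \<open>E t *v u\<close> to
  \<open>u\<close> at \<open>x 0\<close>, which is 1 because \<open>E t\<close> fixes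
  \<open>u\<close>.\<close>

lemma prob_space_kernel: "prob_space (kernel t x)"
proof
  obtain C where C: "\<And>w. w \<in> paths \<Longrightarrow> \<bar>kernel_density t x w\<bar> \<le> C"
    using kernel_density_bounded[of t x] t by auto
  have int: "integrable (\<mu> t x) (kernel_density t x)"
    using t C by (intro integrable_M[of _ C] kernel_density_measurable) auto
  have "emeasure (kernel t x) (space (kernel t x)) = (\<integral>\<^sup>+w. ennreal (kernel_density t x w) \<partial>\<mu> t x)"
    using kernel_density_measurable[of t x] t
    unfolding kernel_def by (subst emeasure_density) 
      (auto simp: measurable_cong_sets[OF sets_M refl] intro!: nn_integral_cong)
  also have "\<dots> = ennreal (LINT w|\<mu> t x. kernel_density t x w)"
    by (rule nn_integral_eq_integral[OF int]) (simp add: kernel_density_nonneg)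
  also have "(LINT w|\<mu> t x. kernel_density t x w) = (LINT w|kernel t x. 1)"
    by (simp only: integral_kernel[OF borel_measurable_const] kernel_density_def 
        mult_1_right integral_mult_right_zero)
  also have "\<dots> = 1"
    using integral_kernel_obs[of "[]"] t u_pos[of "x 0"] by simp
  finally show "emeasure (kernel t x) (space (kernel t x)) = 1" by simp
qed

text \<open>From time \<open>t\<close> on the path is almost surely the shifted \<open>x\<close>, so
  the later factors are constants and leave the integral.\<close>

lemma integral_kernel_obs_append:
  assumes xs: "chain 0 xs t" and ys: "chain t ys T"
  shows "(LINT w|kernel t x. obs (xs @ ys) w) = 
    (ev E 0 u xs t) $ x 0 / u $ x 0 * obs (map (\<lambda>(r, f). (r - t, f)) ys) x"
proof -
  have xs_m: "obs xs \<in> borel_measurable path_space"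
    using chain_ge[OF xs] by (rule obs_measurable)
  have ys_m: "obs ys \<in> borel_measurable path_space"
  proof (rule obs_measurable)
    show "0 \<le> fst z" if "z \<in> set ys" for z
      using chain_ge[OF ys that] t by simp
  qed
  have "(LINT w|kernel t x. obs (xs @ ys) w) = 
      (LINT w|kernel t x. obs xs w * obs (map (\<lambda>(r, f). (r - t, f)) ys) x)"
  proof (rule integral_cong_AE)
    show "AE w in kernel t x. obs (xs @ ys) w = obs xs w * obs (map (\<lambda>(r, f). (r - t, f)) ys) x"
      using AE_kernel_future
    proof eventually_elim
      case (elim w)
      have "obs ys w = obs ys (\<lambda>r. x (r - t))"
      proof (rule obs_cong)
        fix z assume "z \<in> set ys"
        then have "t \<le> fst z" by (rule chain_ge[OF ys])
        then show "w (fst z) = x (fst z - t)"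
          using shift_apply[of "fst z - t" t w] elim by simp
      qed
      then show ?case by (simp add: obs_map_shift)
    qed
    show "obs (xs @ ys) \<in> borel_measurable (kernel t x)"
    proof -
      have "obs (xs @ ys) = (\<lambda>w. obs xs w * obs ys w)" by (simp add: fun_eq_iff)
      then show ?thesis
        unfolding measurable_cong_sets[OF sets_kernel refl] using xs_m ys_m by simp
    qed
    show "(\<lambda>w. obs xs w * obs (map (\<lambda>(r, f). (r - t, f)) ys) x) \<in> borel_measurable (kernel t x)"
      using xs_m by (simp add: measurable_cong_sets[OF sets_kernel refl])
  qed
  then show ?thesis by (simp add: integral_kernel_obs[OF xs])
qed

end

text \<open>Measurability of a probability kernel may be checked on the generating cylinders, where
  the mass is an explicit function of finitely many coordinates of \<open>x\<close>.\<close>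

lemma kernel_measurable:
  assumes t: "0 < t"
  shows "kernel t \<in> measurable path_space (prob_algebra path_space)"
proof (rule measurable_prob_algebra_generated[OF sets_path_space Int_stable_cyls cyls_subset])
  fix A :: "(real \<Rightarrow> 'n) set" assume "A \<in> cyls"
  then obtain zs T where zs: "chain 0 zs T" "\<And>w. w \<in> paths \<Longrightarrow> indicator A w = obs zs w"
    using cyl_indicator by metis
  obtain xs ys where zs_eq: "zs = xs @ ys" and xs: "chain 0 xs t" and ys: "chain t ys (max t T)"
    using chain_split[OF zs(1) less_imp_le[OF t]] by metis
  have A: "A \<in> sets path_space" "A \<inter> paths = A"
    using \<open>A \<in> cyls\<close> cyls_subset by (auto simp: sets_path_space)
  have eq: "emeasure (kernel t x) A = 
      ennreal ((ev E 0 u xs t) $ x 0 / u $ x 0 * obs (map (\<lambda>(r, f). (r - t, f)) ys) x)" 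
    if "x \<in> space path_space" for x
  proof -
    have x: "x \<in> paths" using that by simp
    interpret K: prob_space "kernel t x" by (rule prob_space_kernel[OF t x])
    have "K.prob A = (LINT w|kernel t x. indicator A w)"
      using A t x by simp
    also have "\<dots> = (LINT w|kernel t x. obs zs w)"
      by (rule Bochner_Integration.integral_cong) (use t x zs in simp_all)
    also have "\<dots> = (ev E 0 u xs t) $ x 0 / u $ x 0 * obs (map (\<lambda>(r, f). (r - t, f)) ys) x"
      unfolding zs_eq by (rule integral_kernel_obs_append[OF t x xs ys])
    finally show ?thesis by (simp add: K.emeasure_eq_measure)
  qed
  have "(\<lambda>x. ennreal ((ev E 0 u xs t) $ x 0 / u $ x 0 * obs (map (\<lambda>(r, f). (r - t, f)) ys) x))
      \<in> borel_measurable path_space"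
    using chain_ge[OF ys]
    by (intro measurable_compose[OF _ measurable_ennreal] borel_measurable_times obs_measurable
        measurable_eval_real[where f = "\<lambda>i. (ev E 0 u xs t) $ i / u $ i"]) fastforce+
  then show "(\<lambda>x. emeasure (kernel t x) A) \<in> borel_measurable path_space"
    by (subst measurable_cong[OF eq])
qed (use t prob_space_kernel in auto)

text \<open>Integrating the kernel against a chain leaves a chain observable of \<open>x\<close>
  with one extra factor at time 0, so the finite-dimensional distributions of \<nu> apply directly
  and the semigroup law rejoins the two halves.\<close>

lemma kernel_invariant:
  assumes \<nu>: "prob_space \<nu>" "sets \<nu> = sets path_space"
    and fdd: "\<And>xs T. chain 0 xs T \<Longrightarrow> integral\<^sup>L \<nu> (obs xs) = \<eta> \<bullet> ev E 0 u xs T"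
    and t: "0 < t"
  shows "\<nu> \<bind> kernel t = \<nu>"
proof (rule path_measure_eqI)
  interpret prob_space \<nu> by fact
  have km: "kernel t \<in> measurable \<nu> (prob_algebra path_space)"
    using kernel_measurable[OF t] by (simp add: measurable_cong_sets[OF \<nu>(2) refl])
  have sp: "\<nu> \<in> space (prob_algebra \<nu>)"
    by (simp add: space_prob_algebra \<nu>)
  show "prob_space (\<nu> \<bind> kernel t)" by (rule prob_space_bind'[OF sp km])
  show "sets (\<nu> \<bind> kernel t) = sets path_space" by (rule sets_bind'[OF sp km])
  have spn: "space \<nu> = paths" using sets_eq_imp_space_eq[OF \<nu>(2)] by simp
  fix zs :: "(real \<times> ('n \<Rightarrow> real)) list" and T assume zs: "chain 0 zs T"
  obtain xs ys where zs_eq: "zs = xs @ ys" and xs: "chain 0 xs t" and ys: "chain t ys (max t T)"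
    using chain_split[OF zs(1) less_imp_le[OF t]] by metis
  \<comment> \<open>\<open>h\<close> is the kernel expectation of the observables before
    \<open>t\<close>, given terminal state \<open>i\<close>. Its denominator cancels when
    \<open>h\<close> weights the initial vector \<open>u\<close>.\<close>
  define h where "h i = (ev E 0 u xs t) $ i / u $ i" for i
  define ys' where "ys' = map (\<lambda>(r, f). (r - t, f)) ys"
  have ch: "chain 0 ((0, h) # ys') (max t T - t)"
    using chain_shift[OF ys, of t] by (simp add: ys'_def)
  obtain C where "0 < C" and C: "\<And>w. \<bar>obs zs w\<bar> \<le> C" by (rule obs_bounded[of zs]) (rule that)
  have "integral\<^sup>L (\<nu> \<bind> kernel t) (obs zs) = (LINT x|\<nu>. integral\<^sup>L (kernel t x) (obs zs))"
    by (rule integral_bind_prob[OF \<nu>(1) km obs_measurable[OF chain_ge[OF zs]] C])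
  also have "\<dots> = (LINT x|\<nu>. obs ((0, h) # ys') x)"
  proof (rule Bochner_Integration.integral_cong)
    fix x assume "x \<in> space \<nu>"
    then have "x \<in> paths" by (simp add: spn)
    then show "integral\<^sup>L (kernel t x) (obs zs) = obs ((0, h) # ys') x"
      unfolding zs_eq by (rule integral_kernel_obs_append[OF t _ xs ys, THEN trans]) (simp add: h_def ys'_def)
  qed simp
  also have "\<dots> = \<eta> \<bullet> ev E 0 u ((0, h) # ys') (max t T - t)"
    by (rule fdd[OF ch])
  also have "ev E 0 u ((0, h) # ys') (max t T - t) = ev E 0 (diag_mul h u) ys' (max t T - t)"
    by simp
  also have "diag_mul h u = ev E 0 u xs t"
    using u_pos by (simp add: h_def diag_mul_def vec_eq_iff less_imp_neq[THEN not_sym])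
  also have "ev E 0 (ev E 0 u xs t) ys' (max t T - t) = ev E t (ev E 0 u xs t) ys (max t T)"
    using ev_shift[of E t t _ ys "max t T"] by (simp add: ys'_def)
  also have "\<dots> = ev E 0 u zs (max t T)"
    unfolding zs_eq by (rule ev_append[OF mgroup_E, symmetric])
  also have "\<eta> \<bullet> \<dots> = integral\<^sup>L \<nu> (obs zs)"
    using fdd[OF zs] \<eta>_ev by metis
  finally show "integral\<^sup>L (\<nu> \<bind> kernel t) (obs zs) = integral\<^sup>L \<nu> (obs zs)" .
qed (use \<nu> in auto)

end

section \<open>Gluing independent unit blocks\<close>

text \<open>A stream entry holds one path for every possible starting state; block \<open>n\<close>
  uses the path indexed by the state that block \<open>n - 1\<close> shows at its time 1.\<close>

primrec glue_state :: "'n \<Rightarrow> ('n \<Rightarrow> real \<Rightarrow> 'n) stream \<Rightarrow> nat \<Rightarrow> 'n" where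
  "glue_state b \<omega> 0 = b"
| "glue_state b \<omega> (Suc n) = (\<omega> !! n) (glue_state b \<omega> n) 1"

text \<open>Integer times are read from the new block, so right-continuity there is that of the
  block at 0, and blocks need not fit together for the result to be a path.\<close>

definition glue :: "'n \<Rightarrow> ('n \<Rightarrow> real \<Rightarrow> 'n) stream \<Rightarrow> real \<Rightarrow> 'n" where
  "glue b \<omega> = restrict (\<lambda>t. let n = nat \<lfloor>t\<rfloor> in (\<omega> !! n) (glue_state b \<omega> n) (t - real n)) {0..}"

lemma glue_apply:
  assumes "real n \<le> t" "t < real n + 1"
  shows "glue b \<omega> t = (\<omega> !! n) (glue_state b \<omega> n) (t - real n)"
proof -
  have "\<lfloor>t\<rfloor> = int n" using assms by (simp add: floor_eq_iff)
  moreover have "0 \<le> t" using assms by (auto intro: order_trans)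
  ultimately show ?thesis by (simp add: glue_def)
qed

lemma glue_state_Stream: "glue_state b (x ## \<omega>) (Suc n) = glue_state (x b 1) \<omega> n"
  by (induction n) auto

lemma glue_Stream_first: "0 \<le> t \<Longrightarrow> t < 1 \<Longrightarrow> glue b (x ## \<omega>) t = x b t"
  using glue_apply[of 0 t b "x ## \<omega>"] by simp

lemma glue_Stream_later:
  assumes "1 \<le> t"
  shows "glue b (x ## \<omega>) t = glue (x b 1) \<omega> (t - 1)"
proof -
  define n where "n = nat \<lfloor>t - 1\<rfloor>"
  have n: "real n \<le> t - 1" "t - 1 < real n + 1"
    using assms by (simp_all add: n_def)
  then show ?thesis
    using glue_apply[of "Suc n" t b "x ## \<omega>"] glue_apply[of n "t - 1" "x b 1" \<omega>] 
    by (simp add: glue_state_Stream del: glue_state.simps)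
      (simp add: algebra_simps)
qed

lemma glue_in_paths:
  assumes \<omega>: "\<And>n c. (\<omega> !! n) c \<in> paths"
  shows "glue b \<omega> \<in> paths"
  unfolding paths_iff
proof (intro conjI allI impI)
  show "glue b \<omega> \<in> extensional {0..}" by (simp add: glue_def)
next
  fix t :: real assume t: "0 \<le> t"
  define n where "n = nat \<lfloor>t\<rfloor>"
  have n: "real n \<le> t" "t < real n + 1" using t by (simp_all add: n_def)
  define w where "w = (\<omega> !! n) (glue_state b \<omega> n)"
  have "\<forall>\<^sub>F s in at_right (t - real n). w s = w (t - real n)"
    using \<omega>[of n "glue_state b \<omega> n"] n(1) by (simp add: w_def paths_iff)
  then have "\<forall>\<^sub>F s in at_right t. w (s - real n) = w (t - real n)"
    by (simp add: at_right_to_0[of t] at_right_to_0[of "t - real n"] eventually_filtermap algebra_simps)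
  moreover have "\<forall>\<^sub>F s in at_right t. s \<in> {t<..<real n + 1}"
    by (rule eventually_at_rightI[of t "real n + 1"]) (use n in auto)
  ultimately show "\<forall>\<^sub>F s in at_right t. glue b \<omega> s = glue b \<omega> t"
  proof eventually_elim
    case (elim s)
    then show ?case
      using glue_apply[of n s b \<omega>] glue_apply[of n t b \<omega>] n by (simp add: w_def)
  qed
next
  fix t :: real assume t: "0 < t"
  \<comment> \<open>The left limit at an integer time belongs to the preceding block, hence the
    ceiling minus one in place of the floor.\<close>
  define n where "n = nat (\<lceil>t\<rceil> - 1)"
  have n: "real n < t" "t \<le> real n + 1" using t by (simp_all add: n_def) linarith+
  define w where "w = (\<omega> !! n) (glue_state b \<omega> n)"
  obtain a where "\<forall>\<^sub>F s in at_left (t - real n). w s = a"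
    using \<omega>[of n "glue_state b \<omega> n"] n(1) unfolding w_def paths_iff by (metis diff_gt_0_iff_gt)
  then have "\<forall>\<^sub>F s in at_left t. w (s - real n) = a"
    by (simp add: at_left_minus[of t] at_left_minus[of "t - real n"] at_right_to_0[of "- t"] 
        at_right_to_0[of "real n - t"] eventually_filtermap algebra_simps)
  moreover have "\<forall>\<^sub>F s in at_left t. s \<in> {real n<..<t}"
    by (rule eventually_at_leftI[of "real n"]) (use n in auto)
  ultimately have "\<forall>\<^sub>F s in at_left t. glue b \<omega> s = a"
  proof eventually_elim
    case (elim s)
    then show ?case
      using glue_apply[of n s b \<omega>] n by (simp add: w_def)
  qed
  then show "\<exists>a. \<forall>\<^sub>F s in at_left t. glue b \<omega> s = a" ..
qed

section \<open>Laws of glued paths\<close>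

text \<open>The stream measure is the image of head times tail under \<open>##\<close>, by the
  formula for \<open>emeasure\<close>; Fubini for bounded functions then applies.\<close>

lemma (in prob_space) integral_stream_space:
  fixes f :: "'a stream \<Rightarrow> real"
  assumes f: "f \<in> borel_measurable (stream_space M)" 
    and bound: "\<And>\<omega>. \<omega> \<in> space (stream_space M) \<Longrightarrow> \<bar>f \<omega>\<bar> \<le> C"
  shows "(LINT \<omega>|stream_space M. f \<omega>) = (LINT x|M. (LINT \<omega>|stream_space M. f (x ## \<omega>)))"
proof -
  interpret S: prob_space "stream_space M" by (rule prob_space_stream_space)
  interpret P: pair_prob_space M "stream_space M" ..
  let ?c = "\<lambda>(x, \<omega>). x ## \<omega>"
  let ?D = "distr (M \<Otimes>\<^sub>M stream_space M) (stream_space M) (\<lambda>(x, \<omega>). x ## \<omega>)"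
  have c: "?c \<in> measurable (M \<Otimes>\<^sub>M stream_space M) (stream_space M)"
    by measurable
  have "stream_space M = distr (M \<Otimes>\<^sub>M stream_space M) (stream_space M) ?c" 
  proof (rule measure_eqI)
    fix A assume "A \<in> sets (stream_space M)"
    then have A: "A \<in> sets (stream_space M)" .
    have "emeasure ?D A = (\<integral>\<^sup>+x. emeasure (stream_space M) (Pair x -` (?c -` A \<inter> space (M \<Otimes>\<^sub>M stream_space M))) \<partial>M)"
      using A c by (simp add: emeasure_distr S.emeasure_pair_measure_alt measurable_sets)
    also have "\<dots> = (\<integral>\<^sup>+x. emeasure (stream_space M) {\<omega> \<in> space (stream_space M). x ## \<omega> \<in> A} \<partial>M)"
      by (intro nn_integral_cong arg_cong[where f = "emeasure (stream_space M)"]) (auto simp: space_pair_measure)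
    also have "\<dots> = emeasure (stream_space M) A"
      using emeasure_stream_space[OF A] by simp
    finally show "emeasure (stream_space M) A = emeasure ?D A" by simp
  qed simp
  then have "(LINT \<omega>|stream_space M. f \<omega>) = (LINT \<omega>|?D. f \<omega>)" by simp
  also have "\<dots> = (LINT p|(M \<Otimes>\<^sub>M stream_space M). f (?c p))"
    by (rule integral_distr[OF c f])
  also have "\<dots> = (LINT x|M. (LINT \<omega>|stream_space M. f (?c (x, \<omega>))))"
  proof (rule P.integral_fst'[symmetric])
    show "integrable (M \<Otimes>\<^sub>M stream_space M) (\<lambda>p. f (?c p))"
      using measurable_space[OF c] 
      by (intro P.integrable_const_bound[of _ C] measurable_compose[OF c f] AE_I2) (auto intro: bound)
  qed
  finally show ?thesis by simp
qed

locale gluing =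
  fixes Q :: "'n::finite \<Rightarrow> (real \<Rightarrow> 'n) measure"
  assumes prob_Q: "\<And>b. prob_space (Q b)" and sets_Q: "\<And>b. sets (Q b) = sets path_space"
begin

lemma space_Q: "space (Q b) = paths"
  using sets_eq_imp_space_eq[OF sets_Q] by simp

text \<open>The product over starting states puts a path of law \<open>Q b\<close> for every
  \<open>b\<close> on a single probability space, whose independent copies form the stream.\<close>

definition block :: "('n \<Rightarrow> real \<Rightarrow> 'n) measure" where
  "block = PiM UNIV Q"

sublocale QP: product_prob_space Q UNIV
  by (rule product_prob_spaceI) (rule prob_Q)

lemma prob_block: "prob_space block"
  unfolding block_def by (rule QP.prob_space_axioms)

sublocale block: prob_space block by (rule prob_block)

lemma space_block: "x \<in> space block \<Longrightarrow> x b \<in> paths"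
  by (auto simp: block_def space_PiM space_Q)

lemma component_measurable: "(\<lambda>x. x b) \<in> measurable block path_space"
  unfolding block_def measurable_cong_sets[OF refl sets_Q[of b], symmetric]
  by (rule measurable_component_singleton) simp

lemma integral_component:
  fixes f :: "(real \<Rightarrow> 'n) \<Rightarrow> real"
  assumes "f \<in> borel_measurable path_space"
  shows "(LINT x|block. f (x b)) = (LINT w|Q b. f w)"
proof -
  have "(LINT w|distr block (Q b) (\<lambda>x. x b). f w) = (LINT x|block. f (x b))"
    using assms component_measurable 
    by (intro integral_distr) (simp_all add: measurable_cong_sets[OF refl sets_Q] measurable_cong_sets[OF sets_Q refl])
  moreover have "distr block (Q b) (\<lambda>x. x b) = Q b"
    unfolding block_def by (rule QP.PiM_component) simp
  ultimately show ?thesis by simp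
qed

lemma segment_measurable:
  assumes "0 \<le> r"
  shows "(\<lambda>\<omega>. (\<omega> !! n) c r) \<in> measurable (stream_space block) (count_space UNIV)"
  by (intro measurable_compose[OF measurable_snth measurable_compose[OF component_measurable measurable_eval[OF assms]]])

lemma glue_state_measurable: "(\<lambda>\<omega>. glue_state b \<omega> n) \<in> measurable (stream_space block) (count_space UNIV)"
proof (induction n)
  case (Suc n)
  show ?case
    using measurable_compose_countable[OF segment_measurable[of 1 n] Suc] by simp
qed simp

lemma glue_measurable: "glue b \<in> measurable (stream_space block) path_space"
proof (rule measurable_into_path_space)
  show "glue b \<in> space (stream_space block) \<rightarrow> paths"
  proof
    fix \<omega> assume "\<omega> \<in> space (stream_space block)"
    then have "\<omega> !! n \<in> space block" for n
      by (simp add: space_stream_space snth_in)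
    then show "glue b \<omega> \<in> paths" by (intro glue_in_paths space_block)
  qed
  fix t :: real assume t: "0 \<le> t"
  define n where "n = nat \<lfloor>t\<rfloor>"
  have n: "real n \<le> t" "t < real n + 1" using t by (simp_all add: n_def)
  have "(\<lambda>\<omega>. (\<omega> !! n) (glue_state b \<omega> n) (t - real n)) \<in> measurable (stream_space block) (count_space UNIV)"
    using n by (intro measurable_compose_countable[OF segment_measurable glue_state_measurable]) simp
  then show "(\<lambda>\<omega>. glue b \<omega> t) \<in> measurable (stream_space block) (count_space UNIV)"
    by (simp only: glue_apply[OF n])
qed

definition law :: "'n \<Rightarrow> (real \<Rightarrow> 'n) measure" where
  "law b = distr (stream_space block) path_space (glue b)"

lemma prob_law: "prob_space (law b)"
  unfolding law_def by (rule prob_space.prob_space_distr[OF block.prob_space_stream_space glue_measurable])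

lemma sets_law [simp]: "sets (law b) = sets path_space"
  by (simp add: law_def)

lemma integral_law:
  fixes f :: "(real \<Rightarrow> 'n) \<Rightarrow> real"
  shows "f \<in> borel_measurable path_space \<Longrightarrow> (LINT w|law b. f w) = (LINT \<omega>|stream_space block. f (glue b \<omega>))"
  unfolding law_def by (rule integral_distr[OF glue_measurable])

text \<open>The Markov property at time 1: times below 1 read the first block, later times read the
  glued tail restarted from the value \<open>w 1\<close> of that block, and the tail of the stream
  is independent of its head.\<close>

lemma integral_law_split:
  assumes xs: "\<forall>z\<in>set xs. 0 \<le> fst z \<and> fst z < 1" and ys: "\<forall>z\<in>set ys. 1 \<le> fst z"
  shows "(LINT w|law b. obs (xs @ ys) w) = 
    (LINT w|Q b. obs xs w * (LINT w'|law (w 1). obs (map (\<lambda>(r, f). (r - 1, f)) ys) w'))"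
proof -
  define ys' where "ys' = map (\<lambda>(r, f). (r - 1, f)) ys"
  define \<phi> where "\<phi> c = (LINT w'|law c. obs ys' w')" for c
  have m: "obs (xs @ ys) \<in> borel_measurable path_space" "obs xs \<in> borel_measurable path_space"
    "obs ys' \<in> borel_measurable path_space"
    using xs ys by (auto intro!: obs_measurable simp: ys'_def) force+
  obtain C where "0 < C" and C: "\<And>w. \<bar>obs (xs @ ys) w\<bar> \<le> C" by (rule obs_bounded[of "xs @ ys"]) (rule that)
  have first: "obs xs (glue b (x ## \<omega>)) = obs xs (x b)" for x \<omega>
    using xs by (intro obs_cong) (auto simp: glue_Stream_first)
  have later: "obs ys (glue b (x ## \<omega>)) = obs ys' (glue (x b 1) \<omega>)" for x \<omega>
  proof -
    have "obs ys (glue b (x ## \<omega>)) = obs ys (\<lambda>r. glue (x b 1) \<omega> (r - 1))"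
      using ys by (intro obs_cong) (auto simp: glue_Stream_later)
    then show ?thesis by (simp add: ys'_def obs_map_shift)
  qed
  have "(LINT w|law b. obs (xs @ ys) w) = (LINT \<omega>|stream_space block. obs (xs @ ys) (glue b \<omega>))"
    by (rule integral_law[OF m(1)])
  also have "\<dots> = (LINT x|block. (LINT \<omega>|stream_space block. obs (xs @ ys) (glue b (x ## \<omega>))))"
    using C by (intro block.integral_stream_space[of _ C] measurable_compose[OF glue_measurable m(1)]) auto
  also have "\<dots> = (LINT x|block. obs xs (x b) * \<phi> (x b 1))"
    by (simp add: first later \<phi>_def integral_law[OF m(3)])
  also have "\<dots> = (LINT w|Q b. obs xs w * \<phi> (w 1))"
    by (rule integral_component) (intro borel_measurable_times m measurable_eval_real; simp)
  finally show ?thesis by (simp add: \<phi>_def ys'_def)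
qed

end

section \<open>The invariant measure\<close>

context twisted_kernel
begin

definition stationary_pmf :: "'n pmf" where
  "stationary_pmf = embed_pmf (\<lambda>c. \<eta> $ c * u $ c)"

lemma pmf_stationary: "pmf stationary_pmf c = \<eta> $ c * u $ c"
  unfolding stationary_pmf_def
proof (rule pmf_embed_pmf)
  show nn: "0 \<le> \<eta> $ c * u $ c" for c
    using \<eta>_nonneg[of c] u_pos[of c] by simp
  show "(\<integral>\<^sup>+c. ennreal (\<eta> $ c * u $ c) \<partial>count_space UNIV) = 1"
    using nn \<eta>_u by (simp add: nn_integral_count_space_finite sum_ennreal)
qed

text \<open>Used twice with the same weights: over terminal states to build one block, and over
  initial states to build \<nu>.\<close>

definition mixture :: "('n \<Rightarrow> (real \<Rightarrow> 'n) measure) \<Rightarrow> (real \<Rightarrow> 'n) measure" where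
  "mixture N = measure_pmf stationary_pmf \<bind> N"

lemma
  fixes N :: "'n \<Rightarrow> (real \<Rightarrow> 'n) measure"
  assumes N: "\<And>c. prob_space (N c)" "\<And>c. sets (N c) = sets path_space"
  shows prob_mixture: "prob_space (mixture N)" and sets_mixture: "sets (mixture N) = sets path_space"
    and integral_mixture: "f \<in> borel_measurable path_space \<Longrightarrow> (\<And>w. w \<in> paths \<Longrightarrow> \<bar>f w\<bar> \<le> C) \<Longrightarrow> 
      (LINT w|mixture N. f w) = (\<Sum>c\<in>UNIV. \<eta> $ c * u $ c * (LINT w|N c. f w))"
proof -
  have m: "N \<in> measurable (measure_pmf stationary_pmf) (prob_algebra path_space)"
    by (rule measurableI) (simp_all add: space_prob_algebra N)
  have sp: "measure_pmf stationary_pmf \<in> space (prob_algebra (measure_pmf stationary_pmf))"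
    by (simp add: space_prob_algebra measure_pmf.prob_space_axioms)
  show "prob_space (mixture N)" unfolding mixture_def by (rule prob_space_bind'[OF sp m])
  show "sets (mixture N) = sets path_space" unfolding mixture_def by (rule sets_bind'[OF sp m])
  assume f: "f \<in> borel_measurable path_space" "\<And>w. w \<in> paths \<Longrightarrow> \<bar>f w\<bar> \<le> C"
  have "(LINT w|mixture N. f w) = (LINT c|measure_pmf stationary_pmf. (LINT w|N c. f w))"
    unfolding mixture_def using f
    by (intro integral_bind_prob[OF measure_pmf.prob_space_axioms m, of _ C]) auto
  also have "\<dots> = (\<Sum>c\<in>UNIV. (LINT w|N c. f w) * pmf stationary_pmf c)"
    by (rule integral_measure_pmf_real) auto
  finally show "(LINT w|mixture N. f w) = (\<Sum>c\<in>UNIV. \<eta> $ c * u $ c * (LINT w|N c. f w))"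
    by (simp add: pmf_stationary mult.commute)
qed

definition unit_law :: "(real \<Rightarrow> 'n) measure" where
  "unit_law = mixture (\<lambda>c. kernel 1 (const_path c))"

lemma prob_unit_law: "prob_space unit_law" and sets_unit_law: "sets unit_law = sets path_space"
  unfolding unit_law_def by (intro prob_mixture sets_mixture prob_space_kernel sets_kernel; simp)+

text \<open>The mixing weight contributes a factor \<open>u $ c\<close> that cancels the division by
  \<open>u $ c\<close> in the kernel, leaving a pairing with \<eta>.\<close>

lemma integral_unit_law_obs:
  assumes xs: "chain 0 xs 1"
  shows "(LINT w|unit_law. obs xs w) = \<eta> \<bullet> ev E 0 u xs 1"
proof -
  obtain C where "0 < C" and C: "\<And>w. \<bar>obs xs w\<bar> \<le> C" by (rule obs_bounded[of xs]) (rule that)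
  have "(LINT w|unit_law. obs xs w) = (\<Sum>c\<in>UNIV. \<eta> $ c * u $ c * (LINT w|kernel 1 (const_path c). obs xs w))"
    unfolding unit_law_def
    by (rule integral_mixture[OF _ _ obs_measurable[OF chain_ge[OF xs]] C]) (simp_all add: prob_space_kernel)
  also have "\<dots> = (\<Sum>c\<in>UNIV. \<eta> $ c * ev E 0 u xs 1 $ c)"
    using u_pos by (simp add: integral_kernel_obs[OF _ _ xs] less_imp_neq[THEN not_sym])
  finally show ?thesis by (simp add: inner_vec_def)
qed

definition start_density :: "'n \<Rightarrow> (real \<Rightarrow> 'n) \<Rightarrow> real" where
  "start_density b w = indicator {b} (w 0) / (\<eta> $ b * u $ b)"

text \<open>When state \<open>b\<close> has stationary mass \<open>0\<close>, conditioning on starting in \<open>b\<close> is meaningless and any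
  probability measure serves.\<close>

definition unit_law_from :: "'n \<Rightarrow> (real \<Rightarrow> 'n) measure" where
  "unit_law_from b = (if \<eta> $ b = 0 then unit_law else density unit_law (\<lambda>w. ennreal (start_density b w)))"

lemma start_density_measurable: "start_density b \<in> borel_measurable unit_law"
  unfolding start_density_def measurable_cong_sets[OF sets_unit_law refl] by (rule measurable_eval_real) simp

lemma start_density_nonneg: "0 \<le> start_density b w"
  using \<eta>_nonneg[of b] u_pos[of b] by (simp add: start_density_def)

text \<open>Applied to the initial vector \<open>u\<close>, the conditioning factor leaves the basis
  vector of \<open>b\<close> divided by \<open>\<eta> $ b\<close>, and multiplication by
  \<open>\<eta> $ b\<close> clears the quotient.\<close>

lemma integral_start:
  assumes "chain 0 xs 1" "\<eta> $ b \<noteq> 0"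
  shows "\<eta> $ b * (LINT w|unit_law. start_density b w * obs xs w) = \<eta> \<bullet> ev E 0 (axis b 1) xs 1"
proof -
  have "(LINT w|unit_law. start_density b w * obs xs w) = 
      (LINT w|unit_law. obs ((0, \<lambda>i. indicator {b} i / (\<eta> $ b * u $ b)) # xs) w)"
    by (simp add: start_density_def)
  also have "\<dots> = \<eta> \<bullet> ev E 0 u ((0, \<lambda>i. indicator {b} i / (\<eta> $ b * u $ b)) # xs) 1"
    using assms by (intro integral_unit_law_obs) simp
  also have "ev E 0 u ((0, \<lambda>i. indicator {b} i / (\<eta> $ b * u $ b)) # xs) 1 = 
      ev E 0 (diag_mul (\<lambda>i. indicator {b} i / (\<eta> $ b * u $ b)) u) xs 1"
    by simp
  also have "diag_mul (\<lambda>i. indicator {b} i / (\<eta> $ b * u $ b)) u = (1 / \<eta> $ b) *\<^sub>R axis b 1"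
    using u_pos[of b] by (auto simp: diag_mul_def vec_eq_iff axis_def indicator_def)
  finally show ?thesis
    using assms(2) by (simp add: linear_cmul[OF linear_ev])
qed

lemma sets_unit_law_from: "sets (unit_law_from b) = sets path_space"
  by (simp add: unit_law_from_def sets_unit_law)

lemma prob_unit_law_from: "prob_space (unit_law_from b)"
proof (cases "\<eta> $ b = 0")
  case False
  interpret U: prob_space unit_law by (rule prob_unit_law)
  \<comment> \<open>For the empty list the pairing in \<open>integral_start\<close> equals
    \<open>\<eta> $ b\<close> by left invariance, which cancels.\<close>
  have "(LINT w|unit_law. start_density b w) = 1"
    using integral_start[of "[]" b] False by (simp add: \<eta>_E inner_axis)
  moreover have "integrable unit_law (start_density b)"
    using \<eta>_nonneg[of b] u_pos[of b]
    by (intro U.integrable_const_bound[of _ "1 / (\<eta> $ b * u $ b)"] start_density_measurable AE_I2)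
      (simp add: start_density_def indicator_def)
  ultimately have "(\<integral>\<^sup>+w. ennreal (start_density b w) \<partial>unit_law) = 1"
    using nn_integral_eq_integral[of unit_law "start_density b"] by (simp add: start_density_nonneg)
  then have "emeasure (density unit_law (\<lambda>w. ennreal (start_density b w))) (space unit_law) = 1"
    using start_density_measurable[of b]
    by (subst emeasure_density) (auto intro: nn_integral_cong[THEN trans])
  then show ?thesis
    using False by (intro prob_spaceI) (simp add: unit_law_from_def)
qed (simp add: unit_law_from_def prob_unit_law)

sublocale gluing unit_law_from
  by (rule gluing.intro) (rule prob_unit_law_from sets_unit_law_from)+

text \<open>The factor \<open>\<eta> $ b\<close> makes the formula valid for every \<open>b\<close>:
  at a zero state of \<eta> both sides vanish, whatever law was chosen there.\<close>

lemma integral_unit_law_from: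
  assumes "chain 0 xs 1"
  shows "\<eta> $ b * (LINT w|unit_law_from b. obs xs w) = \<eta> \<bullet> ev E 0 (axis b 1) xs 1"
proof (cases "\<eta> $ b = 0")
  case True
  then show ?thesis by (simp add: \<eta>_ev_axis_0)
next
  case False
  have "(LINT w|unit_law_from b. obs xs w) = (LINT w|unit_law. start_density b w *\<^sub>R obs xs w)"
    unfolding unit_law_from_def
    using False start_density_measurable obs_measurable[OF chain_ge[OF assms]]
    by (simp add: integral_density start_density_nonneg measurable_cong_sets[OF sets_unit_law refl])
  then show ?thesis using integral_start[OF assms False] by simp
qed

text \<open>Induction on a number of blocks exceeding the time horizon. The expectation \<phi> of
  everything after time 1 enters the first block as one more observable at its end.\<close>

lemma integral_law_obs:
  "chain 0 zs T \<Longrightarrow> T < real N \<Longrightarrow> \<eta> $ b * (LINT w|law b. obs zs w) = \<eta> \<bullet> ev E 0 (axis b 1) zs T"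
proof (induction N arbitrary: b zs T)
  case 0
  then show ?case by (auto dest: chain_le)
next
  case (Suc N)
  obtain xs ys where zs: "zs = xs @ ys" and xs: "chain 0 xs 1" "\<forall>z\<in>set xs. fst z < 1" 
    and ys: "chain 1 ys (max 1 T)"
    using chain_split[OF Suc.prems(1), of 1] by auto
  define ys' where "ys' = map (\<lambda>(r, f). (r - 1, f)) ys"
  define \<phi> where "\<phi> c = (LINT w'|law c. obs ys' w')" for c
  \<comment> \<open>The induction hypothesis needs the shifted horizon below \<open>N\<close>. A
    nonempty \<open>ys\<close> forces \<open>1 \<le> T\<close>, which suffices; with no later
    observation the horizon may be too short for it, and total mass 1 is used instead.\<close>
  have \<phi>: "\<eta> $ c * \<phi> c = \<eta> \<bullet> ev E 0 (axis c 1) ys' (max 1 T - 1)" for c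
  proof (cases "ys = []")
    case True
    then show ?thesis
      using prob_space.prob_space[OF prob_law[of c]] by (simp add: \<phi>_def ys'_def \<eta>_E inner_axis)
  next
    case False
    then have "1 \<le> T"
      using ys Suc.prems(1) unfolding zs chain_iff by (cases ys) (auto intro: order_trans)
    moreover have "chain 0 ys' (max 1 T - 1)"
      using chain_shift[OF ys, of 1] by (simp add: ys'_def)
    ultimately show ?thesis
      unfolding \<phi>_def using Suc.prems(2) by (intro Suc.IH) auto
  qed
  define w where "w = ev E 0 (axis b 1) xs 1"
  have "(LINT w|law b. obs zs w) = (LINT w|unit_law_from b. obs (xs @ [(1, \<phi>)]) w)"
  proof -
    have "(LINT w|law b. obs zs w) = (LINT w|unit_law_from b. obs xs w * \<phi> (w 1))"
      unfolding zs \<phi>_def ys'_def using xs chain_ge[OF xs(1)] chain_ge[OF ys]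
      by (intro integral_law_split) auto
    also have "\<dots> = (LINT w|unit_law_from b. obs (xs @ [(1, \<phi>)]) w)"
      by (rule Bochner_Integration.integral_cong) simp_all
    finally show ?thesis .
  qed
  moreover have "chain 0 (xs @ [(1, \<phi>)]) 1"
    by (rule chain_append[OF xs(1)]) simp
  ultimately have "\<eta> $ b * (LINT w|law b. obs zs w) = \<eta> \<bullet> ev E 0 (axis b 1) (xs @ [(1, \<phi>)]) 1"
    by (simp only: integral_unit_law_from)
  also have "ev E 0 (axis b 1) (xs @ [(1, \<phi>)]) 1 = diag_mul \<phi> w"
    by (subst ev_append[OF mgroup_E, of _ _ _ _ _ 1]) (simp add: w_def)
  \<comment> \<open>The regrouping puts \<open>\<eta> $ c\<close> next to \<open>\<phi> c\<close>,
    the only combination that the induction determines.\<close>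
  also have "\<eta> \<bullet> diag_mul \<phi> w = (\<Sum>c\<in>UNIV. w $ c * (\<eta> $ c * \<phi> c))"
    by (simp add: inner_vec_def diag_mul_def ac_simps)
  also have "\<dots> = \<eta> \<bullet> ev E 0 (\<Sum>c\<in>UNIV. w $ c *\<^sub>R axis c 1) ys' (max 1 T - 1)"
    by (simp add: \<phi> linear_sum[OF linear_ev] linear_cmul[OF linear_ev] inner_sum_right)
  also have "\<dots> = \<eta> \<bullet> ev E 1 w ys (max 1 T)"
    using ev_shift[of E 1 1 w ys "max 1 T"] by (simp add: ys'_def flip: vec_expand_axis)
  also have "ev E 1 w ys (max 1 T) = ev E 0 (axis b 1) zs (max 1 T)"
    unfolding zs w_def by (rule ev_append[OF mgroup_E, symmetric])
  also have "\<eta> \<bullet> \<dots> = \<eta> \<bullet> ev E 0 (axis b 1) zs T"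
    by (rule \<eta>_ev)
  finally show ?case .
qed

definition \<nu> :: "(real \<Rightarrow> 'n) measure" where
  "\<nu> = mixture law"

lemma prob_\<nu>: "prob_space \<nu>" and sets_\<nu>: "sets \<nu> = sets path_space"
  unfolding \<nu>_def by (intro prob_mixture sets_mixture prob_law sets_law)+

text \<open>Of each mixing weight, the factor from \<eta> is consumed by
  \<open>integral_law_obs\<close>, and the factors from \<open>u\<close> recombine the basis vectors
  into \<open>u\<close>.\<close>

lemma integral_\<nu>_obs:
  assumes xs: "chain 0 xs T"
  shows "integral\<^sup>L \<nu> (obs xs) = \<eta> \<bullet> ev E 0 u xs T"
proof -
  obtain C where "0 < C" and C: "\<And>w. \<bar>obs xs w\<bar> \<le> C" by (rule obs_bounded[of xs]) (rule that)
  obtain N where N: "T < real N" using reals_Archimedean2 by blast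
  have "integral\<^sup>L \<nu> (obs xs) = (\<Sum>b\<in>UNIV. \<eta> $ b * u $ b * (LINT w|law b. obs xs w))"
    unfolding \<nu>_def
    by (rule integral_mixture[OF prob_law sets_law obs_measurable[OF chain_ge[OF xs]] C])
  also have "\<dots> = (\<Sum>b\<in>UNIV. u $ b * (\<eta> \<bullet> ev E 0 (axis b 1) xs T))"
    by (simp add: ac_simps flip: integral_law_obs[OF xs N])
  also have "\<dots> = \<eta> \<bullet> ev E 0 (\<Sum>b\<in>UNIV. u $ b *\<^sub>R axis b 1) xs T"
    by (simp add: linear_sum[OF linear_ev] linear_cmul[OF linear_ev] inner_sum_right)
  finally show ?thesis by (simp flip: vec_expand_axis)
qed

lemma \<nu>_invariant: "0 < t \<Longrightarrow> \<nu> \<bind> kernel t = \<nu>"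
  by (rule kernel_invariant[OF prob_\<nu> sets_\<nu> integral_\<nu>_obs])

end

section \<open>Invariance under the normalised operator\<close>

theorem theorem2:
  fixes L :: "real^'n^'n"
    and p\<^sub>0 :: "real^'n"
    and \<mu> :: "real \<Rightarrow> (real \<Rightarrow> 'n) \<Rightarrow> (real \<Rightarrow> 'n) measure"
    and V :: "(real \<Rightarrow> 'n) \<Rightarrow> real"
    and v :: "real^'n"
    and lam :: real
    and \<mu>\<^sub>V :: "real^'n"
  assumes "\<And>i. L $ i $ i < 0"
    and "\<And>i j. i \<noteq> j \<Longrightarrow> 0 \<le> L $ i $ j"
    and "\<And>j. (\<Sum>i\<in>UNIV. L $ i $ j) = 0"
    and "prob_vector p\<^sub>0" and "\<And>i. 0 < p\<^sub>0 $ i" and "L *v p\<^sub>0 = 0"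
    and "\<And>t x. 0 < t \<Longrightarrow> x \<in> paths \<Longrightarrow> is_past_measure L p\<^sub>0 t x (\<mu> t x)"
    and "\<And>w. w \<in> paths \<Longrightarrow> V w = v $ w 0"
    and "prob_vector \<mu>\<^sub>V" and "\<And>i. 0 < \<mu>\<^sub>V $ i"
    and "\<And>t. 0 < t \<Longrightarrow> mexp (t *\<^sub>R (L + diag_mat v)) *v \<mu>\<^sub>V = exp (t * lam) *\<^sub>R \<mu>\<^sub>V"
  shows "\<exists>\<nu> :: (real \<Rightarrow> 'n) measure.
           prob_space \<nu> \<and> sets \<nu> = sets path_space \<and>
           (\<forall>t>0. \<forall>g \<in> borel_measurable path_space.
              (\<exists>C. \<forall>w\<in>paths. \<bar>g w\<bar> \<le> C) \<longrightarrow>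
              integrable \<nu> (normalized_op \<mu> p\<^sub>0 V lam \<mu>\<^sub>V t g) \<and>
              (\<integral>x. normalized_op \<mu> p\<^sub>0 V lam \<mu>\<^sub>V t g x \<partial>\<nu>) = (\<integral>w. g w \<partial>\<nu>))"
proof -
  \<comment> \<open>The eigenvalue is moved into the potential, so that \<open>\<mu>\<^sub>V\<close>
    becomes a kernel vector and \<open>path_int\<close> yields the full exponent of the
    operator.\<close>
  define v' where "v' = (\<chi> i. v $ i - lam)"
  have ker: "(L + diag_mat v') *v \<mu>\<^sub>V = 0"
  proof -
    have "(L + diag_mat v) *v \<mu>\<^sub>V = lam *\<^sub>R \<mu>\<^sub>V"
      by (rule generator_eigenvector[OF assms(11)])
    then show ?thesis
      by (simp add: matrix_vector_mult_add_rdistrib diag_mat_mult diag_mul_def v'_def vec_eq_iff algebra_simps)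
  qed
  obtain \<eta> where \<eta>: "\<forall>i. 0 \<le> \<eta> $ i" "\<eta> v* (L + diag_mat v') = 0" "(\<Sum>i\<in>UNIV. \<eta> $ i * \<mu>\<^sub>V $ i) = 1"
    using left_kernel_vector[of "L + diag_mat v'" \<mu>\<^sub>V] ker assms(2,10) by (auto simp: diag_mat_def)
  interpret twisted_kernel L p\<^sub>0 \<mu>\<^sub>V v' \<eta> \<mu>
    by unfold_locales (use assms(2,5,7,10) ker \<eta> in auto)
  \<comment> \<open>Established on \<open>paths\<close>, where \<open>V\<close> is known to depend
    only on the initial state; this is the whole space of \<nu>, so both the integrability and the
    integral can be transferred by congruence.\<close>
  have op: "normalized_op \<mu> p\<^sub>0 V lam \<mu>\<^sub>V t g x = (LINT w|kernel t x. g w)"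
    if t: "0 < t" and x: "x \<in> paths" and g: "g \<in> borel_measurable path_space" for t x and g :: "_ \<Rightarrow> real"
  proof -
    interpret past_measure L p\<^sub>0 t x "\<mu> t x" by (rule past_measureI[OF t x])
    have "(LBINT s:{0..t}. (V (shift s w) - lam)) = path_int (($) v') 0 t w" if w: "w \<in> paths" for w
    proof -
      have "V (shift s w) - lam = v' $ w s" if "s \<in> {0..t}" for s
        using that assms(8)[OF shift_in_paths[OF w]] by (simp add: shift_apply v'_def)
      then have "(LBINT s:{0..t}. (V (shift s w) - lam)) = (LBINT s:{0..t}. v' $ w s)"
        by (intro set_lebesgue_integral_cong) auto
      then show ?thesis using path_int_closed[OF w, of 0 t] t by simp
    qed
    then show ?thesis
      unfolding normalized_op_def transfer_op_def integral_kernel[OF t x g]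
      by (intro arg_cong[where f = "(*) (p\<^sub>0 $ x 0 / \<mu>\<^sub>V $ x 0)"] Bochner_Integration.integral_cong)
        (simp_all add: space_M ac_simps)
  qed
  have space_\<nu>: "space \<nu> = paths"
    using sets_eq_imp_space_eq[OF sets_\<nu>] by simp
  show ?thesis
  proof (intro exI[of _ \<nu>] conjI prob_\<nu> sets_\<nu> allI impI ballI)
    fix t :: real and g :: "(real \<Rightarrow> 'n) \<Rightarrow> real"
    assume t: "0 < t" and g: "g \<in> borel_measurable path_space" and "\<exists>C. \<forall>w\<in>paths. \<bar>g w\<bar> \<le> C"
    then obtain C where C: "\<And>w. w \<in> space path_space \<Longrightarrow> \<bar>g w\<bar> \<le> C" by auto
    have m: "kernel t \<in> measurable \<nu> (prob_algebra path_space)"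
      using kernel_measurable[OF t] by (simp add: measurable_cong_sets[OF sets_\<nu> refl])
    show "integrable \<nu> (normalized_op \<mu> p\<^sub>0 V lam \<mu>\<^sub>V t g)"
      using op[OF t _ g] space_\<nu>
      by (intro iffD2[OF Bochner_Integration.integrable_cong[OF refl] 
            integrable_kernel_integral[OF prob_\<nu> m g C]]) auto
    have "(\<integral>x. normalized_op \<mu> p\<^sub>0 V lam \<mu>\<^sub>V t g x \<partial>\<nu>) = (LINT x|\<nu>. integral\<^sup>L (kernel t x) g)"
      using op[OF t _ g] space_\<nu> by (intro Bochner_Integration.integral_cong) auto
    also have "\<dots> = integral\<^sup>L (\<nu> \<bind> kernel t) g"
      by (rule integral_bind_prob[OF prob_\<nu> m g C, symmetric])
    finally show "(\<integral>x. normalized_op \<mu> p\<^sub>0 V lam \<mu>\<^sub>V t g x \<partial>\<nu>) = (\<integral>w. g w \<partial>\<nu>)"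
      by (simp add: \<nu>_invariant[OF t])
  qed
qed

end
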